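(* Let $\mathfrak{g}$ be a seven-dimensional real Lie algebra which is $(2,3)$-trivial and strongly unimodular. Then $\mathfrak{g}$ does not admit any exact $\mathrm{G}_2$-structure.
   Context: All Lie algebras are real and finite-dimensional. For a Lie algebra $\mathfrak{g}$, $d$ denotes the Chevalley-Eilenberg differential on $\Lambda^\bullet(\mathfrak{g}^* )$, given on 1-forms by $d\alpha(X,Y)=-\alpha([X,Y])$; $H^k(\mathfrak{g})$ is the $k$-th cohomology group of $(\Lambda^\bullet(\mathfrak{g}^* ),d)$ and $b_k(\mathfrak{g})=\dim H^k(\mathfrak{g})$. $\mathfrak{g}$ is called $(2,3)$-trivial if $b_2(\mathfrak{g})=0=b_3(\mathfrak{g})$. (It is known that a Lie algebra other than $\mathbb{R},\mathbb{R}^2$ with $b_3=0$ is solvable, so the following definition applies to seven-dimensional $(2,3)$-trivial Lie algebras.) A solvable Lie algebra $\mathfrak{g}$ with nilradical $\mathfrak{n}$ is strongly unimodular if, setting $\mathfrak{n}^{0}=\mathfrak{n}$ and $\mathfrak{n}^{i}=[\mathfrak{n},\mathfrak{n}^{i-1}]$ for $i\ge 1$ (the descending central series of $\mathfrak{n}$), for every $X\in\mathfrak{g}$ and every $i\geq 0$ the endomorphism of $\mathfrak{n}^{i}/\mathfrak{n}^{i+1}$ induced by $\mathrm{ad}_X$ is traceless. A $\mathrm{G}_2$-structure on a seven-dimensional Lie algebra $\mathfrak{g}$ is a 3-form $\phi\in\Lambda^3(\mathfrak{g}^* )$ such that $\iota_v\phi\wedge\iota_v\phi\wedge\phi\neq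 0\in\Lambda^7(\mathfrak{g}^* )$ for all $v\in\mathfrak{g}\smallsetminus\{0\}$, where $\iota_v$ denotes contraction by $v$. It is exact if $\phi=d\alpha$ for some $\alpha\in\Lambda^2(\mathfrak{g}^* )$. *)

theory Defs
  imports "HOL-Analysis.Analysis" "HOL-Library.Function_Algebras"
begin

section \<open>Bases, dimension and traces on quotients of subspaces\<close>

instantiation "fun" :: (type, real_vector) real_vector
begin

definition scaleR_fun :: "real \<Rightarrow> ('a \<Rightarrow> 'b) \<Rightarrow> 'a \<Rightarrow> 'b"
  where "scaleR_fun c f = (\<lambda>x. c *\<^sub>R f x)"

instance
  by standard (auto simp: scaleR_fun_def fun_eq_iff scaleR_add_right scaleR_add_left)

end

text \<open>For subspaces \<open>W \<subseteq> V\<close>, \<open>quot_basis V W B\<close> says that the cosets \<open>b + W\<close> with \<open>b \<in> B\<close> form a finite basis of \<open>V / W\<close>,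
  and \<open>b \<mapsto> b + W\<close> is injective on \<open>B\<close>.\<close>

definition quot_basis :: "'a::real_vector set \<Rightarrow> 'a set \<Rightarrow> 'a set \<Rightarrow> bool"
  where "quot_basis V W B \<longleftrightarrow> finite B \<and> B \<subseteq> V \<and>
    (\<forall>v\<in>V. \<exists>!c. (\<forall>b. b \<notin> B \<longrightarrow> c b = 0) \<and> v - (\<Sum>b\<in>B. c b *\<^sub>R b) \<in> W)"

definition quot_coord :: "'a::real_vector set \<Rightarrow> 'a set \<Rightarrow> 'a \<Rightarrow> 'a \<Rightarrow> real"
  where "quot_coord W B v =
    (THE c. (\<forall>b. b \<notin> B \<longrightarrow> c b = 0) \<and> v - (\<Sum>b\<in>B. c b *\<^sub>R b) \<in> W)"

definition quot_dim :: "'a::real_vector set \<Rightarrow> 'a set \<Rightarrow> nat"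
  where "quot_dim V W = card (SOME B. quot_basis V W B)"

text \<open>The trace of the endomorphism of \<open>V / W\<close> induced by a linear map \<open>f\<close> preserving \<open>V\<close> and \<open>W\<close>.\<close>

definition basis_trace :: "('a::real_vector \<Rightarrow> 'a) \<Rightarrow> 'a set \<Rightarrow> 'a set \<Rightarrow> real"
  where "basis_trace f W B = (\<Sum>b\<in>B. quot_coord W B (f b) b)"

definition quot_trace :: "('a::real_vector \<Rightarrow> 'a) \<Rightarrow> 'a set \<Rightarrow> 'a set \<Rightarrow> real"
  where "quot_trace f V W = basis_trace f W (SOME B. quot_basis V W B)"

text \<open>The choices are immaterial: quotient bases exist in the finite-dimensional case, and dimension
  and trace do not depend on the basis.\<close>

lemma quot_basis_exists:
  fixes V W :: "'a::real_vector set"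
  assumes V: "subspace V" and W: "subspace W" and WV: "W \<subseteq> V"
    and fin: "finite S" "V \<subseteq> span S"
  shows "\<exists>B. quot_basis V W B"
proof -
  obtain C where C: "C \<subseteq> W" "independent C" "W \<subseteq> span C"
    by (rule maximal_independent_subset)
  obtain D where D: "C \<subseteq> D" "D \<subseteq> V" "independent D" "V \<subseteq> span D"
    using maximal_independent_subset_extend[of C V] C WV by blast
  have finD: "finite D"
    using independent_span_bound[OF fin(1) D(3)] D(2) fin(2) by blast
  have spC: "span C = W"
    using C W by (simp add: span_minimal subset_antisym)
  define B where "B = D - C"
  have finB: "finite B" and finC: "finite C"
    using finD D(1) by (auto simp: B_def intro: finite_subset)
  have "quot_basis V W B"
    unfolding quot_basis_def
  proof (intro conjI ballI)
    show "finite B" "B \<subseteq> V" using finB D(2) by (auto simp: B_def)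
    fix v assume v: "v \<in> V"
    show "\<exists>!c. (\<forall>b. b \<notin> B \<longrightarrow> c b = 0) \<and> v - (\<Sum>b\<in>B. c b *\<^sub>R b) \<in> W"
    proof (rule ex_ex1I)
      obtain u where u: "v = (\<Sum>b\<in>D. u b *\<^sub>R b)"
        using v D(4) finD by (auto simp: span_finite)
      have split: "(\<Sum>b\<in>D. u b *\<^sub>R b) = (\<Sum>b\<in>B. u b *\<^sub>R b) + (\<Sum>b\<in>C. u b *\<^sub>R b)"
        unfolding B_def using sum.subset_diff[OF D(1) finD] by metis
      have "(\<Sum>b\<in>C. u b *\<^sub>R b) \<in> W"
        using C(1) W by (intro subspace_sum subspace_scale) auto
      moreover have "(\<Sum>b\<in>B. (if b \<in> B then u b else 0) *\<^sub>R b) = (\<Sum>b\<in>B. u b *\<^sub>R b)"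
        by (rule sum.cong) auto
      ultimately show "\<exists>c. (\<forall>b. b \<notin> B \<longrightarrow> c b = 0) \<and> v - (\<Sum>b\<in>B. c b *\<^sub>R b) \<in> W"
        using u split by (intro exI[of _ "\<lambda>b. if b \<in> B then u b else 0"]) simp
    next
      fix c c'
      assume c: "(\<forall>b. b \<notin> B \<longrightarrow> c b = 0) \<and> v - (\<Sum>b\<in>B. c b *\<^sub>R b) \<in> W"
        and c': "(\<forall>b. b \<notin> B \<longrightarrow> c' b = 0) \<and> v - (\<Sum>b\<in>B. c' b *\<^sub>R b) \<in> W"
      have "(v - (\<Sum>b\<in>B. c' b *\<^sub>R b)) - (v - (\<Sum>b\<in>B. c b *\<^sub>R b)) \<in> W"
        by (rule subspace_diff[OF W]) (use c c' in auto)
      then have "(\<Sum>b\<in>B. (c b - c' b) *\<^sub>R b) \<in> span C"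
        by (simp add: spC scaleR_diff_left sum_subtractf)
      then obtain w where w: "(\<Sum>b\<in>B. (c b - c' b) *\<^sub>R b) = (\<Sum>b\<in>C. w b *\<^sub>R b)"
        using finC by (auto simp: span_finite)
      define u where "u b = (if b \<in> C then - w b else c b - c' b)" for b
      have "(\<Sum>b\<in>D. u b *\<^sub>R b) = (\<Sum>b\<in>B. u b *\<^sub>R b) + (\<Sum>b\<in>C. u b *\<^sub>R b)"
        unfolding B_def using sum.subset_diff[OF D(1) finD] by metis
      also have "(\<Sum>b\<in>B. u b *\<^sub>R b) = (\<Sum>b\<in>B. (c b - c' b) *\<^sub>R b)"
        by (rule sum.cong) (auto simp: u_def B_def)
      also have "(\<Sum>b\<in>C. u b *\<^sub>R b) = - (\<Sum>b\<in>C. w b *\<^sub>R b)"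
        unfolding sum_negf[symmetric] by (rule sum.cong) (auto simp: u_def)
      finally have "(\<Sum>b\<in>D. u b *\<^sub>R b) = 0" using w by simp
      then have "\<forall>b\<in>D. u b = 0"
        using independentD[OF D(3) finD subset_refl] by blast
      then have "c b = c' b" if "b \<in> B" for b
        using that by (auto simp: u_def B_def)
      then show "c = c'" using c c' by (intro ext) metis
    qed
  qed
  then show ?thesis ..
qed

lemma quot_coord_unique:
  assumes "quot_basis V W B" "v \<in> V" "\<And>b. b \<notin> B \<Longrightarrow> c b = 0"
    "v - (\<Sum>b\<in>B. c b *\<^sub>R b) \<in> W"
  shows "quot_coord W B v = c"
  unfolding quot_coord_def using assms unfolding quot_basis_def
  by (intro the1_equality) auto

lemma quot_coord_spec:
  assumes "quot_basis V W B" "v \<in> V"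
  shows "b \<notin> B \<Longrightarrow> quot_coord W B v b = 0"
    and "v - (\<Sum>b\<in>B. quot_coord W B v b *\<^sub>R b) \<in> W"
proof -
  have "\<exists>!c. (\<forall>b. b \<notin> B \<longrightarrow> c b = 0) \<and> v - (\<Sum>b\<in>B. c b *\<^sub>R b) \<in> W"
    using assms by (auto simp: quot_basis_def)
  from theI'[OF this, folded quot_coord_def]
  show "b \<notin> B \<Longrightarrow> quot_coord W B v b = 0"
    and "v - (\<Sum>b\<in>B. quot_coord W B v b *\<^sub>R b) \<in> W" by auto
qed

lemma quot_coord_mod:
  assumes B: "quot_basis V W B" and V: "subspace V" and W: "subspace W" and WV: "W \<subseteq> V"
    and v: "v \<in> V" and u: "v - u \<in> W"
  shows "quot_coord W B u = quot_coord W B v"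
proof (rule quot_coord_unique[OF B])
  have "v - (v - u) \<in> V" by (rule subspace_diff[OF V]) (use v u WV in auto)
  then show "u \<in> V" by simp
  show "\<And>b. b \<notin> B \<Longrightarrow> quot_coord W B v b = 0" using quot_coord_spec(1)[OF B v] .
  have "(v - (\<Sum>b\<in>B. quot_coord W B v b *\<^sub>R b)) - (v - u) \<in> W"
    by (rule subspace_diff[OF W quot_coord_spec(2)[OF B v] u])
  then show "u - (\<Sum>b\<in>B. quot_coord W B v b *\<^sub>R b) \<in> W" by (simp add: algebra_simps)
qed

lemma quot_coord_sum:
  assumes B: "quot_basis V W B" and V: "subspace V" and W: "subspace W"
    and I: "finite I" "\<And>i. i \<in> I \<Longrightarrow> g i \<in> V"
  shows "quot_coord W B (\<Sum>i\<in>I. a i *\<^sub>R g i) b = (\<Sum>i\<in>I. a i * quot_coord W B (g i) b)"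
proof -
  have "quot_coord W B (\<Sum>i\<in>I. a i *\<^sub>R g i) = (\<lambda>b. \<Sum>i\<in>I. a i * quot_coord W B (g i) b)"
  proof (rule quot_coord_unique[OF B])
    show "(\<Sum>i\<in>I. a i *\<^sub>R g i) \<in> V" using V I by (intro subspace_sum subspace_scale) auto
    show "\<And>b. b \<notin> B \<Longrightarrow> (\<Sum>i\<in>I. a i * quot_coord W B (g i) b) = 0"
      using quot_coord_spec(1)[OF B I(2)] by (intro sum.neutral) auto
    have "(\<Sum>i\<in>I. a i *\<^sub>R (g i - (\<Sum>b\<in>B. quot_coord W B (g i) b *\<^sub>R b))) \<in> W"
      using quot_coord_spec(2)[OF B I(2)] W by (intro subspace_sum subspace_scale) auto
    also have "(\<Sum>i\<in>I. a i *\<^sub>R (g i - (\<Sum>b\<in>B. quot_coord W B (g i) b *\<^sub>R b)))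
      = (\<Sum>i\<in>I. a i *\<^sub>R g i) - (\<Sum>i\<in>I. \<Sum>b\<in>B. (a i * quot_coord W B (g i) b) *\<^sub>R b)"
      by (simp add: scaleR_diff_right sum_subtractf scaleR_sum_right)
    also have "(\<Sum>i\<in>I. \<Sum>b\<in>B. (a i * quot_coord W B (g i) b) *\<^sub>R b)
      = (\<Sum>b\<in>B. (\<Sum>i\<in>I. a i * quot_coord W B (g i) b) *\<^sub>R b)"
      by (subst sum.swap) (simp add: scaleR_sum_left)
    finally show "(\<Sum>i\<in>I. a i *\<^sub>R g i) - (\<Sum>b\<in>B. (\<Sum>i\<in>I. a i * quot_coord W B (g i) b) *\<^sub>R b) \<in> W" .
  qed
  then show ?thesis by simp
qed

lemma basis_trace_unique:
  assumes B: "quot_basis V W B" and C: "quot_basis V W C"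
    and V: "subspace V" and W: "subspace W" and WV: "W \<subseteq> V"
    and f: "linear f" "f ` V \<subseteq> V" "f ` W \<subseteq> W"
  shows "basis_trace f W B = basis_trace f W C"
proof -
  interpret f: linear f by fact
  have fin: "finite B" "finite C" and sub: "B \<subseteq> V" "C \<subseteq> V"
    using B C by (auto simp: quot_basis_def)
  let ?\<beta> = "quot_coord W B" and ?\<gamma> = "quot_coord W C"
  have "?\<beta> (f b) b = (\<Sum>c\<in>C. ?\<gamma> (f b) c * ?\<beta> c b)" if "b \<in> B" for b
  proof -
    have fb: "f b \<in> V" using that sub f(2) by auto
    have "?\<beta> (f b) = ?\<beta> (\<Sum>c\<in>C. ?\<gamma> (f b) c *\<^sub>R c)"
      by (rule quot_coord_mod[OF B V W WV fb, symmetric]) (rule quot_coord_spec(2)[OF C fb])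
    moreover have "?\<beta> (\<Sum>c\<in>C. ?\<gamma> (f b) c *\<^sub>R c) b = (\<Sum>c\<in>C. ?\<gamma> (f b) c * ?\<beta> c b)"
      by (rule quot_coord_sum[OF B V W fin(2)]) (use sub in auto)
    ultimately show ?thesis by simp
  qed
  then have 1: "basis_trace f W B = (\<Sum>b\<in>B. \<Sum>c\<in>C. ?\<gamma> (f b) c * ?\<beta> c b)"
    unfolding basis_trace_def by (rule sum.cong[OF refl])
  have "?\<gamma> (f c) c = (\<Sum>b\<in>B. ?\<beta> c b * ?\<gamma> (f b) c)" if "c \<in> C" for c
  proof -
    have c: "c \<in> V" "f c \<in> V" using that sub f(2) by auto
    have "f (c - (\<Sum>b\<in>B. ?\<beta> c b *\<^sub>R b)) \<in> W"
      using quot_coord_spec(2)[OF B c(1)] f(3) by auto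
    then have "f c - (\<Sum>b\<in>B. ?\<beta> c b *\<^sub>R f b) \<in> W"
      by (simp add: f.diff f.sum f.scaleR)
    then have "?\<gamma> (f c) = ?\<gamma> (\<Sum>b\<in>B. ?\<beta> c b *\<^sub>R f b)"
      by (rule quot_coord_mod[OF C V W WV c(2), symmetric])
    moreover have "?\<gamma> (\<Sum>b\<in>B. ?\<beta> c b *\<^sub>R f b) c = (\<Sum>b\<in>B. ?\<beta> c b * ?\<gamma> (f b) c)"
      by (rule quot_coord_sum[OF C V W fin(1)]) (use sub f(2) in auto)
    ultimately show ?thesis by simp
  qed
  then have 2: "basis_trace f W C = (\<Sum>c\<in>C. \<Sum>b\<in>B. ?\<beta> c b * ?\<gamma> (f b) c)"
    unfolding basis_trace_def by (rule sum.cong[OF refl])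
  show ?thesis unfolding 1 2 by (subst sum.swap) (simp add: mult.commute)
qed

lemma quot_coord_basis:
  assumes B: "quot_basis V W B" and W: "subspace W" and b: "b \<in> B"
  shows "quot_coord W B b b = 1"
proof -
  have "quot_coord W B b = (\<lambda>x. if x = b then 1 else 0)"
  proof (rule quot_coord_unique[OF B])
    show "b \<in> V" using B b by (auto simp: quot_basis_def)
    have "(\<Sum>x\<in>B. (if x = b then 1 else 0) *\<^sub>R x) = (\<Sum>x\<in>B. if x = b then b else 0)"
      by (rule sum.cong) auto
    also have "\<dots> = b"
      using b B by (simp add: quot_basis_def)
    finally show "b - (\<Sum>x\<in>B. (if x = b then 1 else 0) *\<^sub>R x) \<in> W"
      using W by (simp add: subspace_0)
  qed (use b in auto)
  then show ?thesis by simp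
qed

lemma quot_basis_card_unique:
  assumes B: "quot_basis V W B" and C: "quot_basis V W C"
    and V: "subspace V" and W: "subspace W" and WV: "W \<subseteq> V"
  shows "card B = card C"
proof -
  have "real (card D) = basis_trace (\<lambda>x. x) W D" if "quot_basis V W D" for D
    unfolding basis_trace_def using quot_coord_basis[OF that W] by simp
  moreover have "basis_trace (\<lambda>x. x) W B = basis_trace (\<lambda>x. x) W C"
    by (rule basis_trace_unique[OF B C V W WV]) (auto simp: linear_id[unfolded id_def])
  ultimately show ?thesis using B C by (metis of_nat_eq_iff)
qed

lemma quot_dim_eq:
  assumes "quot_basis V W B" "subspace V" "subspace W" "W \<subseteq> V"
  shows "quot_dim V W = card B"
  unfolding quot_dim_def using assms
  by (metis quot_basis_card_unique someI)

lemma quot_trace_eq: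
  assumes "quot_basis V W B" "subspace V" "subspace W" "W \<subseteq> V"
    "linear f" "f ` V \<subseteq> V" "f ` W \<subseteq> W"
  shows "quot_trace f V W = basis_trace f W B"
  unfolding quot_trace_def by (rule basis_trace_unique[OF someI[of "quot_basis V W", OF assms(1)]]) (use assms in auto)


section \<open>Lie algebras\<close>

definition lie_algebra :: "('a::real_vector \<Rightarrow> 'a \<Rightarrow> 'a) \<Rightarrow> bool"
  where "lie_algebra br \<longleftrightarrow> bilinear br \<and> (\<forall>x. br x x = 0) \<and>
    (\<forall>x y z. br x (br y z) + br y (br z x) + br z (br x y) = 0)"

definition bracket_span :: "('a::real_vector \<Rightarrow> 'a \<Rightarrow> 'a) \<Rightarrow> 'a set \<Rightarrow> 'a set \<Rightarrow> 'a set"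
  where "bracket_span br A B = span {br a b | a b. a \<in> A \<and> b \<in> B}"

fun derived_series :: "('a::real_vector \<Rightarrow> 'a \<Rightarrow> 'a) \<Rightarrow> nat \<Rightarrow> 'a set"
  where
    "derived_series br 0 = UNIV"
  | "derived_series br (Suc i) = bracket_span br (derived_series br i) (derived_series br i)"

definition solvable :: "('a::real_vector \<Rightarrow> 'a \<Rightarrow> 'a) \<Rightarrow> bool"
  where "solvable br \<longleftrightarrow> (\<exists>i. derived_series br i = {0})"

fun central_series :: "('a::real_vector \<Rightarrow> 'a \<Rightarrow> 'a) \<Rightarrow> 'a set \<Rightarrow> nat \<Rightarrow> 'a set"
  where
    "central_series br N 0 = N"
  | "central_series br N (Suc i) = bracket_span br N (central_series br N i)"

definition lie_ideal :: "('a::real_vector \<Rightarrow> 'a \<Rightarrow> 'a) \<Rightarrow> 'a set \<Rightarrow> bool"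
  where "lie_ideal br I \<longleftrightarrow> subspace I \<and> (\<forall>x. \<forall>y\<in>I. br x y \<in> I)"

definition nilpotent_ideal :: "('a::real_vector \<Rightarrow> 'a \<Rightarrow> 'a) \<Rightarrow> 'a set \<Rightarrow> bool"
  where "nilpotent_ideal br I \<longleftrightarrow> lie_ideal br I \<and> (\<exists>i. central_series br I i = {0})"

text \<open>The sum of all nilpotent ideals; in finite dimension it is the largest nilpotent ideal.\<close>

definition nilradical :: "('a::real_vector \<Rightarrow> 'a \<Rightarrow> 'a) \<Rightarrow> 'a set"
  where "nilradical br = span (\<Union>{I. nilpotent_ideal br I})"

definition strongly_unimodular :: "('a::real_vector \<Rightarrow> 'a \<Rightarrow> 'a) \<Rightarrow> bool"
  where "strongly_unimodular br \<longleftrightarrow> solvable br \<and>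
    (\<forall>x i. quot_trace (br x) (central_series br (nilradical br) i)
                            (central_series br (nilradical br) (Suc i)) = 0)"


section \<open>Exterior forms and Chevalley-Eilenberg cohomology\<close>

text \<open>A \<open>k\<close>-form is an alternating multilinear function of lists of length \<open>k\<close>. It is extended by \<open>0\<close>
  to lists of other lengths, so that equality of functions is equality of forms.\<close>

definition forms :: "nat \<Rightarrow> ('a::real_vector list \<Rightarrow> real) set"
  where "forms k = {\<omega>.
    (\<forall>xs. length xs \<noteq> k \<longrightarrow> \<omega> xs = 0) \<and>
    (\<forall>xs i. length xs = k \<and> i < k \<longrightarrow> linear (\<lambda>x. \<omega> (xs[i := x]))) \<and>
    (\<forall>xs i j. length xs = k \<and> i < j \<and> j < k \<and> xs ! i = xs ! j \<longrightarrow> \<omega> xs = 0)}"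

text \<open>The factor \<open>nths xs (- {i, j})\<close> is \<open>xs\<close> without its entries at the positions \<open>i\<close> and \<open>j\<close>. No degree
  is needed: for \<open>\<omega> \<in> forms k\<close> the right-hand side vanishes unless \<open>length xs = Suc k\<close>.\<close>

definition ce_diff :: "('a::real_vector \<Rightarrow> 'a \<Rightarrow> 'a) \<Rightarrow> ('a list \<Rightarrow> real) \<Rightarrow> 'a list \<Rightarrow> real"
  where "ce_diff br \<omega> xs =
    (\<Sum>j<length xs. \<Sum>i<j. (- 1) ^ (i + j) * \<omega> (br (xs ! i) (xs ! j) # nths xs (- {i, j})))"

lemma ce_diff_1: "ce_diff br \<alpha> [x, y] = - \<alpha> [br x y]"
  by (simp add: ce_diff_def lessThan_Suc nths_Cons)

lemma ce_diff_2:
  "ce_diff br \<alpha> [x, y, z] = - \<alpha> [br x y, z] + \<alpha> [br x z, y] - \<alpha> [br y z, x]"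
  by (simp add: ce_diff_def lessThan_Suc nths_Cons eval_nat_numeral)

definition cocycles :: "('a::real_vector \<Rightarrow> 'a \<Rightarrow> 'a) \<Rightarrow> nat \<Rightarrow> ('a list \<Rightarrow> real) set"
  where "cocycles br k = {\<omega> \<in> forms k. ce_diff br \<omega> = 0}"

fun coboundaries :: "('a::real_vector \<Rightarrow> 'a \<Rightarrow> 'a) \<Rightarrow> nat \<Rightarrow> ('a list \<Rightarrow> real) set"
  where
    "coboundaries br 0 = {0}"
  | "coboundaries br (Suc k) = ce_diff br ` forms k"

definition betti :: "('a::real_vector \<Rightarrow> 'a \<Rightarrow> 'a) \<Rightarrow> nat \<Rightarrow> nat"
  where "betti br k = quot_dim (cocycles br k) (coboundaries br k)"

definition two_three_trivial :: "('a::real_vector \<Rightarrow> 'a \<Rightarrow> 'a) \<Rightarrow> bool"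
  where "two_three_trivial br \<longleftrightarrow> betti br 2 = 0 \<and> betti br 3 = 0"

definition wedge ::
    "nat \<Rightarrow> nat \<Rightarrow> ('a list \<Rightarrow> real) \<Rightarrow> ('a list \<Rightarrow> real) \<Rightarrow> 'a list \<Rightarrow> real"
  where "wedge p q \<alpha> \<beta> xs =
    (if length xs = p + q
     then (\<Sum>\<sigma> | \<sigma> permutes {..<p + q}. of_int (sign \<sigma>) *
             \<alpha> (take p (permute_list \<sigma> xs)) * \<beta> (drop p (permute_list \<sigma> xs)))
          / (fact p * fact q)
     else 0)"

definition contract :: "'a \<Rightarrow> ('a list \<Rightarrow> real) \<Rightarrow> 'a list \<Rightarrow> real"
  where "contract v \<omega> xs = \<omega> (v # xs)"


section \<open>Exact G2-structures\<close>

definition g2_structure :: "('a::real_vector list \<Rightarrow> real) \<Rightarrow> bool"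
  where "g2_structure \<phi> \<longleftrightarrow> \<phi> \<in> forms 3 \<and>
    (\<forall>v. v \<noteq> 0 \<longrightarrow> wedge 4 3 (wedge 2 2 (contract v \<phi>) (contract v \<phi>)) \<phi> \<noteq> 0)"

definition exact_form :: "('a::real_vector \<Rightarrow> 'a \<Rightarrow> 'a) \<Rightarrow> nat \<Rightarrow> ('a list \<Rightarrow> real) \<Rightarrow> bool"
  where "exact_form br k \<phi> \<longleftrightarrow> \<phi> \<in> coboundaries br k"

end

theory Submission
  imports Defs
begin

text \<open>
  Let \<open>n\<close> be the nilradical. Since \<open>g\<close> is solvable and \<open>b\<^sub>2 = 0\<close>, \<open>n = [g, g]\<close> has codimension one; choose \<open>t\<close> outside
  \<open>n\<close>. Let \<open>Z\<close> be the last nonzero term of the lower central series of \<open>n\<close>. It is central in \<open>n\<close>, and \<open>ad t\<close> is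
  traceless on it. Suppose that \<open>\<phi> = d\<alpha>\<close> is a G2-structure, so that \<open>\<phi>(x, y, \<cdot>) \<noteq> 0\<close> for independent \<open>x, y\<close>. For \<open>x, y \<in> Z\<close>,
  \<open>\<phi>(x, y, \<cdot>)\<close> vanishes on \<open>n\<close>, and \<open>\<phi>(x, y, t) = -\<alpha>([t, x], y) - \<alpha>(x, [t, y])\<close>.
  If \<open>dim Z \<ge> 3\<close>, the linear form \<open>y \<mapsto> \<phi>(x, y, t)\<close> on \<open>Z\<close> vanishes for some \<open>y\<close> independent of \<open>x\<close>.
  If \<open>dim Z = 2\<close>, the formula equals \<open>-tr(ad t |\<^sub>Z) \<alpha>(x, y) = 0\<close>.
  If \<open>Z\<close> is spanned by \<open>x\<close>, then \<open>x\<close> is central in \<open>g\<close>, and \<open>\<iota>\<^sub>x\<phi>\<close> is an exact symplectic form on the unimodular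
  Lie algebra \<open>g / x\<close>, which is impossible.
\<close>

section \<open>Finite-dimensional vector spaces\<close>

text \<open>Lie's theorem is not at hand over the reals, where \<open>ad\<close> need not have
  eigenvalues. Traces take its place: an operator on a nonzero quotient whose positive powers are
  all traceless is singular, and the traces needed vanish by tr(AB) = tr(BA). With the
  irreducibility of chief factors this shows that [g, g] acts trivially on each of them, which makes
  [g, g] nilpotent. The identification n = [g, g] links the two hypotheses: strong unimodularity
  speaks of the nilradical, whereas b_2 = 0 controls [g, g]. The trace conditions enter twice. The
  last one says that \<open>ad\<close> is traceless on Z; for dim Z = 1 this is what makes x commute
  with t. The others add up to tracelessness on n/Z and, since the action on g/n is zero, to
  unimodularity of g/Z. An exact symplectic form excludes this: the vector dual to its primitive
  acts as an infinitesimal conformal map, with trace half the dimension. No quotient Lie algebra is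
  constructed: quotients are pairs of subspaces of g, and a symplectic form on a quotient is a skew
  form on g with prescribed radical.\<close>

lemma separating_functional:
  fixes S :: "'a::real_vector set"
  assumes "subspace S" "y \<notin> S"
  obtains f :: "'a \<Rightarrow> real" where "linear f" "f y = 1" "\<forall>x\<in>S. f x = 0"
proof -
  obtain C where C: "C \<subseteq> S" "independent C" "S \<subseteq> span C"
    by (rule maximal_independent_subset)
  have sp: "span C = S" using C assms by (simp add: span_minimal subset_antisym)
  have ind: "independent (insert y C)"
    by (rule independent_insertI) (use assms sp C in auto)
  define \<delta> :: "'a \<Rightarrow> real" where "\<delta> x = (if x = y then 1 else 0)" for x
  obtain f :: "'a \<Rightarrow> real" where f: "linear f" "\<forall>x\<in>insert y C. f x = \<delta> x"
    using linear_independent_extend[OF ind, of \<delta>] by (elim exE conjE)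
  have "f x = 0" if "x \<in> S" for x
  proof -
    have "y \<notin> C" using assms C by auto
    then have "\<And>x. x \<in> C \<Longrightarrow> f x = 0" using f(2) by (auto simp: \<delta>_def)
    then show ?thesis using linear_eq_0_on_span[OF f(1), of C x] that sp by simp
  qed
  moreover have "f y = 1" using f(2) by (simp add: \<delta>_def)
  ultimately show ?thesis using that f(1) by simp
qed

text \<open>The type is an arbitrary real vector space, so finiteness comes from the spanning set
  \<open>S\<close>. Strictness is what drives the choices of ideals and subspaces of extremal
  dimension.\<close>

lemma dim_psubset_less:
  fixes U V :: "'a::real_vector set"
  assumes S: "finite S" "V \<subseteq> span S" and U: "subspace U" "U \<subset> V"
  shows "dim U < dim V"
proof -
  obtain C where C: "C \<subseteq> U" "independent C" "U \<subseteq> span C"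
    by (rule maximal_independent_subset)
  obtain D where D: "C \<subseteq> D" "D \<subseteq> V" "independent D" "V \<subseteq> span D"
    using maximal_independent_subset_extend[of C V] C U by blast
  have finD: "finite D"
    using independent_span_bound[OF S(1) D(3)] D(2) S(2) by blast
  have "span C \<subseteq> U" using C U by (simp add: span_minimal)
  then have "C \<noteq> D" using D(4) U(2) by auto
  then have "card C < card D" using D(1) finD by (simp add: psubset_card_mono psubsetI)
  moreover have "dim U = card C" "dim V = card D"
    using C D by (auto intro: dim_unique)
  ultimately show ?thesis by simp
qed

section \<open>Traces on quotients\<close>

locale quotient_basis =
  fixes V W B :: "'a::real_vector set"
  assumes basis: "quot_basis V W B" and V: "subspace V" and W: "subspace W" and WV: "W \<subseteq> V"
begin

definition preserves :: "('a \<Rightarrow> 'a) \<Rightarrow> bool"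
  where "preserves f \<longleftrightarrow> linear f \<and> f ` V \<subseteq> V \<and> f ` W \<subseteq> W"

abbreviation "tr f \<equiv> basis_trace f W B"

lemma finite_B: "finite B" and B_sub: "B \<subseteq> V"
  using basis by (auto simp: quot_basis_def)

lemma coord_add:
  assumes "u \<in> V" "v \<in> V"
  shows "quot_coord W B (u + v) b = quot_coord W B u b + quot_coord W B v b"
  using quot_coord_sum[OF basis V W, of "{True, False}" "\<lambda>i. if i then u else v" "\<lambda>_. 1" b] assms by auto

lemma coord_scale:
  assumes "u \<in> V"
  shows "quot_coord W B (r *\<^sub>R u) b = r * quot_coord W B u b"
  using quot_coord_sum[OF basis V W, of "{True}" "\<lambda>i. u" "\<lambda>_. r" b] assms by auto

lemma tr_cong:
  assumes "f ` V \<subseteq> V" "\<And>v. v \<in> V \<Longrightarrow> f v - g v \<in> W"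
  shows "tr f = tr g"
  unfolding basis_trace_def
proof (rule sum.cong[OF refl])
  fix b assume "b \<in> B"
  then have b: "b \<in> V" using B_sub by auto
  show "quot_coord W B (f b) b = quot_coord W B (g b) b"
    using quot_coord_mod[OF basis V W WV _ assms(2)[OF b]] assms(1) b by auto
qed

lemma tr_0: "(\<And>v. v \<in> V \<Longrightarrow> f v \<in> W) \<Longrightarrow> tr f = 0"
proof -
  assume a: "\<And>v. v \<in> V \<Longrightarrow> f v \<in> W"
  have "tr f = tr (\<lambda>_. 0)" by (rule tr_cong) (use a WV in auto)
  also have "\<dots> = 0" unfolding basis_trace_def
    using coord_scale[of 0 0] subspace_0[OF V] by (intro sum.neutral) auto
  finally show ?thesis .
qed

lemma tr_add: "f ` V \<subseteq> V \<Longrightarrow> g ` V \<subseteq> V \<Longrightarrow> tr (\<lambda>x. f x + g x) = tr f + tr g"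
  unfolding basis_trace_def sum.distrib[symmetric]
  by (rule sum.cong[OF refl], rule coord_add) (use B_sub in \<open>auto simp: image_subset_iff\<close>)

lemma tr_scale: "f ` V \<subseteq> V \<Longrightarrow> tr (\<lambda>x. r *\<^sub>R f x) = r * tr f"
  unfolding basis_trace_def sum_distrib_left
  by (rule sum.cong[OF refl], rule coord_scale) (use B_sub in \<open>auto simp: image_subset_iff\<close>)

lemma tr_diff: "f ` V \<subseteq> V \<Longrightarrow> g ` V \<subseteq> V \<Longrightarrow> tr (\<lambda>x. f x - g x) = tr f - tr g"
proof -
  assume a: "f ` V \<subseteq> V" "g ` V \<subseteq> V"
  have "tr (\<lambda>x. f x + (-1) *\<^sub>R g x) = tr f + tr (\<lambda>x. (-1) *\<^sub>R g x)"
    using a V by (intro tr_add) (auto intro: subspace_neg)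
  then show ?thesis using tr_scale[OF a(2), of "-1"] by simp
qed

lemma tr_sum: "finite I \<Longrightarrow> (\<And>i. i \<in> I \<Longrightarrow> f i ` V \<subseteq> V) \<Longrightarrow> tr (\<lambda>x. \<Sum>i\<in>I. f i x) = (\<Sum>i\<in>I. tr (f i))"
proof (induction I rule: finite_induct)
  case empty
  then show ?case using tr_0[of "\<lambda>_. 0"] subspace_0[OF W] by simp
next
  case (insert i I)
  have "tr (\<lambda>x. f i x + (\<Sum>i\<in>I. f i x)) = tr (f i) + tr (\<lambda>x. \<Sum>i\<in>I. f i x)"
    using insert V by (intro tr_add) (auto intro!: subspace_sum)
  then show ?case using insert by simp
qed

lemma tr_id: "tr (\<lambda>x. x) = real (card B)"
  unfolding basis_trace_def using quot_coord_basis[OF basis W] by simp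

lemma coord_apply:
  assumes g: "preserves g" and v: "v \<in> V"
  shows "quot_coord W B (g v) b = (\<Sum>c\<in>B. quot_coord W B v c * quot_coord W B (g c) b)"
proof -
  interpret g: linear g using g by (simp add: preserves_def)
  have "g (v - (\<Sum>c\<in>B. quot_coord W B v c *\<^sub>R c)) \<in> W"
    using quot_coord_spec(2)[OF basis v] g by (auto simp: preserves_def)
  then have "g v - (\<Sum>c\<in>B. quot_coord W B v c *\<^sub>R g c) \<in> W"
    by (simp add: g.diff g.sum g.scaleR)
  then have "quot_coord W B (g v) = quot_coord W B (\<Sum>c\<in>B. quot_coord W B v c *\<^sub>R g c)"
    using quot_coord_mod[OF basis V W WV] g v by (auto simp: preserves_def image_subset_iff)
  then show ?thesis
    using quot_coord_sum[OF basis V W finite_B, of g] B_sub g by (auto simp: preserves_def image_subset_iff)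
qed

lemma tr_comm:
  assumes f: "preserves f" and g: "preserves g"
  shows "tr (\<lambda>x. f (g x)) = tr (\<lambda>x. g (f x))"
proof -
  have *: "tr (\<lambda>x. f (g x)) = (\<Sum>b\<in>B. \<Sum>c\<in>B. quot_coord W B (g b) c * quot_coord W B (f c) b)"
    if "preserves f" "preserves g" for f g
    unfolding basis_trace_def
    by (rule sum.cong[OF refl], rule coord_apply) (use that B_sub in \<open>auto simp: preserves_def image_subset_iff\<close>)
  show ?thesis unfolding *[OF f g] *[OF g f]
    by (subst sum.swap) (simp add: mult.commute)
qed

lemma preserves_comp: "preserves f \<Longrightarrow> preserves g \<Longrightarrow> preserves (\<lambda>x. f (g x))"
  unfolding preserves_def using linear_compose[of g f] by (auto simp: o_def image_subset_iff)

lemma preserves_id: "preserves (\<lambda>x. x)"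
  unfolding preserves_def using linear_id by (auto simp: id_def)

lemma preserves_pow: "preserves f \<Longrightarrow> preserves (f ^^ m)"
  by (induction m) (auto simp: preserves_id[unfolded id_def[symmetric]] o_def intro: preserves_comp)

lemma basis_empty_iff: "B = {} \<longleftrightarrow> V = W"
proof
  assume "B = {}"
  then show "V = W" using quot_coord_spec(2)[OF basis] WV by auto
next
  assume "V = W"
  \<comment> \<open>The identity then maps \<open>V\<close> into \<open>W\<close>, so its trace is
    0; but this trace counts \<open>B\<close>.\<close>
  then have "tr (\<lambda>x. x) = 0" by (intro tr_0) auto
  then show "B = {}" using tr_id finite_B by simp
qed

text \<open>The matrices of the powers of \<open>f\<close> lie in the finite-dimensional space of
  functions on \<open>B \<times> B\<close>, so they are linearly dependent. This gives an
  annihilating polynomial without determinants.\<close>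

lemma power_relation:
  assumes f: "preserves f"
  shows "\<exists>N c. (\<exists>m\<le>N. c m \<noteq> 0) \<and> (\<forall>v\<in>V. (\<Sum>m\<le>N. c m *\<^sub>R (f ^^ m) v) \<in> W)"
proof -
  define M :: "nat \<Rightarrow> 'a \<times> 'a \<Rightarrow> real" where
    "M m = (\<lambda>(b, b'). if b \<in> B \<and> b' \<in> B then quot_coord W B ((f ^^ m) b) b' else 0)" for m
  \<comment> \<open>The matrix units; \<open>M m\<close> is the matrix of \<open>f ^^ m\<close>,
    extended by 0 outside \<open>B \<times> B\<close>.\<close>
  define E :: "'a \<times> 'a \<Rightarrow> 'a \<times> 'a \<Rightarrow> real" where "E p = (\<lambda>q. if q = p then 1 else 0)" for p
  have ME: "M m = (\<Sum>p\<in>B\<times>B. M m p *\<^sub>R E p)" for m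
  proof
    fix q
    have sf: "(\<Sum>p\<in>I. g p) q = (\<Sum>p\<in>I. g p q)" for g :: "'a \<times> 'a \<Rightarrow> 'a \<times> 'a \<Rightarrow> real" and I
      by (induction I rule: infinite_finite_induct) auto
    have "(\<Sum>p\<in>B\<times>B. M m p *\<^sub>R E p) q = (\<Sum>p\<in>B\<times>B. if p = q then M m q else 0)"
      unfolding sf by (rule sum.cong) (auto simp: E_def scaleR_fun_def)
    also have "\<dots> = M m q" using finite_B by (auto simp: M_def split: prod.splits)
    finally show "M m q = (\<Sum>p\<in>B\<times>B. M m p *\<^sub>R E p) q" by simp
  qed
  have Msp: "M m \<in> span (E ` (B \<times> B))" for m
    by (subst ME) (intro span_sum span_scale span_base, auto)
  obtain c :: "nat \<Rightarrow> real" and N where c: "\<exists>m\<le>N. c m \<noteq> 0" "(\<Sum>m\<le>N. c m *\<^sub>R M m) = 0"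
  proof (cases "inj M")
    case True
    have "\<not> independent (range M)"
    proof
      assume "independent (range M)"
      then have "finite (range M)"
        using independent_span_bound[of "E ` (B \<times> B)" "range M"] finite_B Msp by auto
      then show False using True finite_imageD by blast
    qed
    then obtain T u where T: "finite T" "T \<subseteq> range M" "(\<Sum>v\<in>T. u v *\<^sub>R v) = 0" "\<exists>v\<in>T. u v \<noteq> 0"
      unfolding dependent_explicit by auto
    define I where "I = M -` T"
    have finI: "finite I" unfolding I_def by (rule finite_vimageI[OF T(1) True])
    have TI: "T = M ` I" using T(2) by (auto simp: I_def)
    obtain N where N: "I \<subseteq> {..N}" using finI finite_nat_iff_bounded_le by auto
    have "(\<Sum>m\<le>N. (if m \<in> I then u (M m) else 0) *\<^sub>R M m) = (\<Sum>m\<in>I. u (M m) *\<^sub>R M m)"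
      by (rule sum.mono_neutral_cong_right) (use N in auto)
    also have "\<dots> = (\<Sum>v\<in>T. u v *\<^sub>R v)"
      unfolding TI using True by (subst sum.reindex) (auto intro: inj_on_subset)
    finally have "(\<Sum>m\<le>N. (if m \<in> I then u (M m) else 0) *\<^sub>R M m) = 0" using T by simp
    moreover have "\<exists>m\<le>N. (if m \<in> I then u (M m) else 0) \<noteq> 0"
      using T(4) TI N by auto
    ultimately show ?thesis using that[of N "\<lambda>m. if m \<in> I then u (M m) else 0"] by blast
  next
    \<comment> \<open>Dependence is a property of the set \<open>range M\<close> and does not see
      repetitions. Two equal powers give the relation with coefficients 1 and -1 directly.\<close>
    case False
    then obtain i j where ij: "M i = M j" "i < j" by (metis injI linorder_neqE_nat)
    define c :: "nat \<Rightarrow> real" where "c m = (if m = i then 1 else if m = j then -1 else 0)" for m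
    have "(\<Sum>m\<le>j. c m *\<^sub>R M m) = (\<Sum>m\<in>{i,j}. c m *\<^sub>R M m)"
      by (rule sum.mono_neutral_right) (use ij in \<open>auto simp: c_def\<close>)
    also have "\<dots> = 0" using ij by (simp add: c_def)
    finally show ?thesis
    proof (rule that[rotated])
      show "\<exists>m\<le>j. c m \<noteq> 0" using ij by (intro exI[of _ j]) (simp add: c_def)
    qed
  qed
  have "(\<Sum>m\<le>N. c m *\<^sub>R (f ^^ m) v) \<in> W" if v: "v \<in> V" for v
  proof -
    have fm: "(f ^^ m) u \<in> V" if "u \<in> V" for m u using preserves_pow[OF f] that by (auto simp: preserves_def)
    let ?x = "\<Sum>m\<le>N. c m *\<^sub>R (f ^^ m) v"
    have x: "?x \<in> V" using V fm v by (intro subspace_sum subspace_scale) auto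
    have "quot_coord W B ?x b = 0" if b: "b \<in> B" for b
    proof -
      have "quot_coord W B ?x b = (\<Sum>m\<le>N. c m * quot_coord W B ((f ^^ m) v) b)"
        by (rule quot_coord_sum[OF basis V W]) (use fm v in auto)
      also have "\<dots> = (\<Sum>m\<le>N. c m * (\<Sum>d\<in>B. quot_coord W B v d * M m (d, b)))"
        by (rule sum.cong[OF refl]) (subst coord_apply[OF preserves_pow[OF f] v], simp add: M_def b)
      also have "\<dots> = (\<Sum>m\<le>N. \<Sum>d\<in>B. quot_coord W B v d * (c m * M m (d, b)))"
        by (simp add: sum_distrib_left mult_ac)
      also have "\<dots> = (\<Sum>d\<in>B. quot_coord W B v d * (\<Sum>m\<le>N. c m * M m (d, b)))"
        by (subst sum.swap) (simp add: sum_distrib_left)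
      also have "\<dots> = 0"
      proof (rule sum.neutral, rule ballI)
        fix d assume "d \<in> B"
        have sf: "(\<Sum>p\<in>I. g p) q = (\<Sum>p\<in>I. g p q)" for g :: "nat \<Rightarrow> 'a \<times> 'a \<Rightarrow> real" and I q
          by (induction I rule: infinite_finite_induct) auto
        have "(\<Sum>m\<le>N. c m * M m (d, b)) = 0"
          using fun_cong[OF c(2), of "(d, b)"] by (simp add: sf scaleR_fun_def)
        then show "quot_coord W B v d * (\<Sum>m\<le>N. c m * M m (d, b)) = 0" by simp
      qed
      finally show ?thesis .
    qed
    then show ?thesis using quot_coord_spec(2)[OF basis x] by simp
  qed
  then show ?thesis using c(1) by (intro exI[of _ N] exI[of _ c]) simp
qed

text \<open>If \<open>f\<close> is injective, a polynomial relation for \<open>f\<close> can be divided by a power of \<open>f\<close>.\<close>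

lemma injective_power_relation:
  assumes f: "preserves f" and inj: "\<And>v. v \<in> V \<Longrightarrow> f v \<in> W \<Longrightarrow> v \<in> W"
  shows "\<exists>N c. c 0 \<noteq> (0::real) \<and> (\<forall>v\<in>V. (\<Sum>m\<le>N. c m *\<^sub>R (f ^^ m) v) \<in> W)"
proof -
  have fm: "(f ^^ m) u \<in> V" if "u \<in> V" for m u using preserves_pow[OF f] that by (auto simp: preserves_def)
  have injm: "v \<in> W" if "v \<in> V" "(f ^^ m) v \<in> W" for m v
    using that(2)
  proof (induction m)
    case (Suc m)
    then show ?case using inj[OF fm[OF that(1)], of m] by simp
  qed simp
  obtain N c where "(\<exists>m\<le>N. c m \<noteq> 0) \<and> (\<forall>v\<in>V. (\<Sum>m\<le>N. c m *\<^sub>R (f ^^ m) v) \<in> W)"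
    using power_relation[OF f] by (elim exE)
  then have c: "\<exists>m\<le>N. c m \<noteq> 0" "\<forall>v\<in>V. (\<Sum>m\<le>N. c m *\<^sub>R (f ^^ m) v) \<in> W" by simp_all
  define r where "r = (LEAST m. m \<le> N \<and> c m \<noteq> 0)"
  have r: "r \<le> N" "c r \<noteq> 0" using LeastI_ex[OF c(1)] unfolding r_def by blast+
  have less: "c m = 0" if "m < r" for m
    using not_less_Least[OF that[unfolded r_def]] that r(1) by simp
  let ?p = "\<lambda>v. \<Sum>m\<le>N-r. c (r + m) *\<^sub>R (f ^^ m) v"
  have "?p v \<in> W" if v: "v \<in> V" for v
  proof (rule injm[of _ r])
    show "?p v \<in> V" using V fm v by (intro subspace_sum subspace_scale) auto
    have lin: "linear (f ^^ r)" using preserves_pow[OF f] by (auto simp: preserves_def)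
    have "(f ^^ r) (?p v) = (\<Sum>m\<le>N-r. c (r + m) *\<^sub>R (f ^^ (r + m)) v)"
      by (simp add: linear_sum[OF lin] linear_scale[OF lin] funpow_add)
    also have "\<dots> = (\<Sum>m=r..N. c m *\<^sub>R (f ^^ m) v)"
      by (rule sum.reindex_bij_witness[of _ "\<lambda>m. m - r" "\<lambda>m. r + m"]) (use r(1) in auto)
    also have "\<dots> = (\<Sum>m\<le>N. c m *\<^sub>R (f ^^ m) v)"
      by (rule sum.mono_neutral_left) (use less in auto)
    finally show "(f ^^ r) (?p v) \<in> W" using c(2) v by simp
  qed
  then show ?thesis using r(2) by (intro exI[of _ "N - r"] exI[of _ "\<lambda>m. c (r + m)"]) simp
qed

text \<open>In a relation with nonzero constant term, all terms but the first lie in the image of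
  \<open>f\<close>. Solving for the constant term exhibits \<open>v\<close> as an image modulo
  \<open>W\<close>.\<close>

lemma injective_imp_surjective:
  assumes f: "preserves f" and inj: "\<And>v. v \<in> V \<Longrightarrow> f v \<in> W \<Longrightarrow> v \<in> W" and v: "v \<in> V"
  shows "\<exists>u\<in>V. v - f u \<in> W"
proof -
  have lin: "linear f" using f by (simp add: preserves_def)
  have "\<exists>N c. c 0 \<noteq> (0::real) \<and> (\<forall>v\<in>V. (\<Sum>m\<le>N. c m *\<^sub>R (f ^^ m) v) \<in> W)"
    by (rule injective_power_relation[OF f]) (rule inj)
  then obtain N c where "c 0 \<noteq> (0::real) \<and> (\<forall>v\<in>V. (\<Sum>m\<le>N. c m *\<^sub>R (f ^^ m) v) \<in> W)"
    by (elim exE)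
  then have c: "c 0 \<noteq> 0" "(\<Sum>m\<le>N. c m *\<^sub>R (f ^^ m) v) \<in> W" using v by simp_all
  define u where "u = (\<Sum>m<N. c (Suc m) *\<^sub>R (f ^^ m) v)"
  have u: "u \<in> V" unfolding u_def
    using preserves_pow[OF f] v by (intro subspace_sum[OF V] subspace_scale[OF V]) (auto simp: preserves_def)
  have "(\<Sum>m\<le>N. c m *\<^sub>R (f ^^ m) v) = c 0 *\<^sub>R v + f u"
    unfolding u_def lessThan_Suc_atMost[symmetric] sum.lessThan_Suc_shift
    by (simp add: linear_sum[OF lin] linear_scale[OF lin])
  then have "(1 / c 0) *\<^sub>R (c 0 *\<^sub>R v + f u) \<in> W" using c(2) W by (simp add: subspace_scale)
  then have "v - f (- ((1 / c 0) *\<^sub>R u)) \<in> W"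
    using c(1) by (simp add: scaleR_add_right linear_scale[OF lin] linear_neg[OF lin])
  then show ?thesis using u V by (intro bexI[of _ "- ((1 / c 0) *\<^sub>R u)"] subspace_neg subspace_scale)
qed

text \<open>If \<open>f\<close> were injective on \<open>V / W\<close>, there would be a relation
  p(f) = 0 with p(0) nonzero. Taking its trace leaves only p(0) dim(V/W), which therefore vanishes.
  No eigenvalue is involved, so the argument works over the reals.\<close>

lemma traceless_powers_singular:
  assumes f: "preserves f" and tr: "\<And>m. m \<ge> 1 \<Longrightarrow> tr (f ^^ m) = 0" and ne: "V \<noteq> W"
  obtains v where "v \<in> V" "v \<notin> W" "f v \<in> W"
proof (rule ccontr)
  assume "\<not> thesis"
  with that have inj: "v \<in> W" if "v \<in> V" "f v \<in> W" for v using that by blast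
  have fm: "(f ^^ m) u \<in> V" if "u \<in> V" for m u using preserves_pow[OF f] that by (auto simp: preserves_def)
  have "\<exists>N c. c 0 \<noteq> (0::real) \<and> (\<forall>v\<in>V. (\<Sum>m\<le>N. c m *\<^sub>R (f ^^ m) v) \<in> W)"
    by (rule injective_power_relation[OF f]) (rule inj)
  then obtain N c where "c 0 \<noteq> (0::real) \<and> (\<forall>v\<in>V. (\<Sum>m\<le>N. c m *\<^sub>R (f ^^ m) v) \<in> W)"
    by (elim exE)
  then have c: "c 0 \<noteq> 0" "\<And>v. v \<in> V \<Longrightarrow> (\<Sum>m\<le>N. c m *\<^sub>R (f ^^ m) v) \<in> W" by simp_all
  have "0 = tr (\<lambda>v. \<Sum>m\<le>N. c m *\<^sub>R (f ^^ m) v)" using tr_0[OF c(2)] by simp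
  also have "\<dots> = (\<Sum>m\<le>N. c m * tr (f ^^ m))"
    by (subst tr_sum) (use fm V in \<open>auto simp: tr_scale image_subset_iff intro: subspace_scale\<close>)
  also have "\<dots> = (\<Sum>m\<in>{0}. c m * tr (f ^^ m))"
    by (rule sum.mono_neutral_right) (use tr in auto)
  also have "\<dots> = c 0 * real (card B)" using tr_id by (simp add: id_def)
  finally show False using c(1) ne basis_empty_iff finite_B by auto
qed

lemma coord_basis:
  assumes b: "b \<in> B"
  shows "quot_coord W B b = (\<lambda>x. if x = b then 1 else 0)"
proof (rule quot_coord_unique[OF basis])
  have "(\<Sum>x\<in>B. (if x = b then 1 else 0) *\<^sub>R x) = (\<Sum>x\<in>B. if x = b then b else 0)"
    by (rule sum.cong) auto
  also have "\<dots> = b" using b finite_B by simp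
  finally show "b - (\<Sum>x\<in>B. (if x = b then 1 else 0) *\<^sub>R x) \<in> W"
    using W by (simp add: subspace_0)
qed (use b B_sub in auto)

lemma coord_W: "w \<in> W \<Longrightarrow> quot_coord W B w b = 0"
  using fun_cong[OF quot_coord_unique[OF basis, of w "\<lambda>_. 0"]] WV by auto

lemma coord_combination:
  assumes "b \<in> B"
  shows "quot_coord W B (\<Sum>x\<in>B. c x *\<^sub>R x) b = c b"
proof -
  have "quot_coord W B (\<Sum>x\<in>B. c x *\<^sub>R x) b = (\<Sum>x\<in>B. c x * (if b = x then 1 else 0))"
    using B_sub by (subst quot_coord_sum[OF basis V W finite_B]) (auto simp: coord_basis)
  also have "\<dots> = (\<Sum>x\<in>B. if b = x then c b else 0)" by (rule sum.cong) auto
  finally show ?thesis using assms finite_B by simp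
qed

end

lemma quot_basis_union:
  assumes B: "quot_basis V U B" and C: "quot_basis U W C"
    and V: "subspace V" and U: "subspace U" and W: "subspace W" and UV: "U \<subseteq> V" "W \<subseteq> U"
  shows "B \<inter> C = {}" "quot_basis V W (B \<union> C)"
proof -
  interpret B: quotient_basis V U B by standard fact+
  interpret C: quotient_basis U W C by standard fact+
  show dis: "B \<inter> C = {}"
  proof (rule ccontr)
    assume "B \<inter> C \<noteq> {}"
    then obtain b where b: "b \<in> B" "b \<in> U" using C.B_sub by auto
    have "quot_coord U B b = quot_coord U B 0"
      using quot_coord_mod[OF B V U UV(1), of 0 b] b U V by (simp add: subspace_0 subspace_neg)
    then show False using quot_coord_basis[OF B U b(1)] B.coord_scale[of 0 0 b] subspace_0[OF V] by simp
  qed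
  have split: "(\<Sum>b\<in>B \<union> C. c b *\<^sub>R b) = (\<Sum>b\<in>B. c b *\<^sub>R b) + (\<Sum>b\<in>C. c b *\<^sub>R b)" for c
    using B.finite_B C.finite_B dis by (simp add: sum.union_disjoint)
  show "quot_basis V W (B \<union> C)"
    unfolding quot_basis_def
  proof (intro conjI ballI ex_ex1I)
    show "finite (B \<union> C)" "B \<union> C \<subseteq> V" using B.finite_B C.finite_B B.B_sub C.B_sub UV by auto
    fix v assume v: "v \<in> V"
    let ?b = "quot_coord U B v"
    define u where "u = v - (\<Sum>b\<in>B. ?b b *\<^sub>R b)"
    let ?c = "quot_coord W C u"
    have u: "u \<in> U" unfolding u_def by (rule quot_coord_spec(2)[OF B v])
    \<comment> \<open>Coordinates in two stages: those of \<open>v\<close> modulo \<open>U\<close>,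
      and those of the remainder \<open>u\<close>, which lies in \<open>U\<close>, modulo
      \<open>W\<close>.\<close>
    let ?d = "\<lambda>x. if x \<in> B then ?b x else ?c x"
    have "(\<Sum>b\<in>B. ?d b *\<^sub>R b) = (\<Sum>b\<in>B. ?b b *\<^sub>R b)"
      by (rule sum.cong) simp_all
    moreover have "(\<Sum>b\<in>C. ?d b *\<^sub>R b) = (\<Sum>b\<in>C. ?c b *\<^sub>R b)"
    proof (rule sum.cong[OF refl])
      fix b assume "b \<in> C"
      then have "b \<notin> B" using dis by blast
      then show "?d b *\<^sub>R b = ?c b *\<^sub>R b" by simp
    qed
    ultimately have "v - (\<Sum>b\<in>B \<union> C. ?d b *\<^sub>R b) \<in> W"
      using quot_coord_spec(2)[OF C u] by (simp add: split u_def algebra_simps)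
    moreover have "\<forall>b. b \<notin> B \<union> C \<longrightarrow> ?d b = 0" using quot_coord_spec(1)[OF C u] by auto
    ultimately show "\<exists>c. (\<forall>b. b \<notin> B \<union> C \<longrightarrow> c b = 0) \<and> v - (\<Sum>b\<in>B \<union> C. c b *\<^sub>R b) \<in> W"
      by (intro exI[of _ ?d] conjI)
    have uniq: "c = ?d" if c: "(\<forall>b. b \<notin> B \<union> C \<longrightarrow> c b = 0) \<and> v - (\<Sum>b\<in>B \<union> C. c b *\<^sub>R b) \<in> W" for c
    proof -
      have sC: "(\<Sum>b\<in>C. c b *\<^sub>R b) \<in> U" using C.B_sub U by (intro subspace_sum subspace_scale) auto
      have "(v - (\<Sum>b\<in>B \<union> C. c b *\<^sub>R b)) + (\<Sum>b\<in>C. c b *\<^sub>R b) \<in> U"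
        using c UV sC U by (intro subspace_add) auto
      then have "v - (\<Sum>b\<in>B. (if b \<in> B then c b else 0) *\<^sub>R b) \<in> U"
        by (simp add: split cong: sum.cong)
      then have 1: "?b = (\<lambda>b. if b \<in> B then c b else 0)"
        by (intro quot_coord_unique[OF B v]) auto
      then have "u = v - (\<Sum>b\<in>B. c b *\<^sub>R b)" by (simp add: u_def cong: sum.cong)
      then have "u - (\<Sum>b\<in>C. (if b \<in> C then c b else 0) *\<^sub>R b) \<in> W"
        using c by (simp add: split diff_diff_eq cong: sum.cong)
      then have 2: "?c = (\<lambda>b. if b \<in> C then c b else 0)"
        by (intro quot_coord_unique[OF C u]) auto
      show ?thesis unfolding 1 2 using c by (auto simp: fun_eq_iff)
    qed
    fix c c' assume "(\<forall>b. b \<notin> B \<union> C \<longrightarrow> c b = 0) \<and> v - (\<Sum>b\<in>B \<union> C. c b *\<^sub>R b) \<in> W"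
      "(\<forall>b. b \<notin> B \<union> C \<longrightarrow> c' b = 0) \<and> v - (\<Sum>b\<in>B \<union> C. c' b *\<^sub>R b) \<in> W"
    then show "c = c'" using uniq[of c] uniq[of c'] by simp
  qed
qed

text \<open>In the basis \<open>B \<union> C\<close> the matrix of \<open>f\<close> is block
  triangular, with the matrices on \<open>V / U\<close> and \<open>U / W\<close> as diagonal
  blocks.\<close>

lemma quot_trace_additive:
  assumes V: "subspace V" and U: "subspace U" and W: "subspace W" and UV: "U \<subseteq> V" "W \<subseteq> U"
    and fin: "finite S" "V \<subseteq> span S"
    and f: "linear f" "f ` V \<subseteq> V" "f ` U \<subseteq> U" "f ` W \<subseteq> W"
  shows "quot_trace f V W = quot_trace f V U + quot_trace f U W"
proof -
  obtain B where B: "quot_basis V U B" using quot_basis_exists[OF V U UV(1) fin] by blast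
  obtain C where C: "quot_basis U W C" using quot_basis_exists[OF U W UV(2) fin(1)] fin UV by blast
  note BC = quot_basis_union[OF B C V U W UV]
  interpret B: quotient_basis V U B by standard fact+
  interpret C: quotient_basis U W C by standard fact+
  interpret BC: quotient_basis V W "B \<union> C" by standard (use BC V W UV in auto)
  have coord: "quot_coord W (B \<union> C) v b = quot_coord U B v b" if "v \<in> V" "b \<in> B" for v b
  proof -
    let ?c = "quot_coord W (B \<union> C) v"
    have "v - (\<Sum>b\<in>B \<union> C. ?c b *\<^sub>R b) \<in> U" using quot_coord_spec(2)[OF BC(2) that(1)] UV by auto
    moreover have "(\<Sum>b\<in>C. ?c b *\<^sub>R b) \<in> U" using C.B_sub U by (intro subspace_sum subspace_scale) auto
    ultimately have "(v - (\<Sum>b\<in>B \<union> C. ?c b *\<^sub>R b)) + (\<Sum>b\<in>C. ?c b *\<^sub>R b) \<in> U"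
      using U by (intro subspace_add) auto
    then have "v - (\<Sum>b\<in>B. (if b \<in> B then ?c b else 0) *\<^sub>R b) \<in> U"
      using B.finite_B C.finite_B BC(1) by (simp add: sum.union_disjoint cong: sum.cong)
    then have "quot_coord U B v = (\<lambda>b. if b \<in> B then ?c b else 0)"
      by (intro quot_coord_unique[OF B that(1)]) auto
    then show ?thesis using that by simp
  qed
  have coord': "quot_coord W (B \<union> C) v b = quot_coord W C v b" if "v \<in> U" "b \<in> C" for v b
  proof -
    have "quot_coord W (B \<union> C) v = quot_coord W C v"
    proof (rule quot_coord_unique[OF BC(2)])
      show "v \<in> V" using that UV by auto
      show "\<And>b. b \<notin> B \<union> C \<Longrightarrow> quot_coord W C v b = 0" using quot_coord_spec(1)[OF C that(1)] by auto
      have "(\<Sum>b\<in>B. quot_coord W C v b *\<^sub>R b) = 0"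
        using quot_coord_spec(1)[OF C that(1)] BC(1) by (intro sum.neutral) auto
      then show "v - (\<Sum>b\<in>B \<union> C. quot_coord W C v b *\<^sub>R b) \<in> W"
        using quot_coord_spec(2)[OF C that(1)] B.finite_B C.finite_B BC(1) by (simp add: sum.union_disjoint)
    qed
    then show ?thesis by simp
  qed
  have "basis_trace f W (B \<union> C) = basis_trace f U B + basis_trace f W C"
    unfolding basis_trace_def using B.finite_B C.finite_B BC(1) B.B_sub C.B_sub f
    by (subst sum.union_disjoint) (auto simp: image_subset_iff subset_iff intro!: arg_cong2[of _ _ _ _ "(+)"] sum.cong coord coord')
  then show ?thesis
    using quot_trace_eq[OF BC(2) V W] quot_trace_eq[OF B V U] quot_trace_eq[OF C U W] f UV by auto
qed

section \<open>Skew-symmetric bilinear forms\<close>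

text \<open>Since \<open>W\<close> is the radical, this is a symplectic form on the quotient by
  \<open>W\<close>, expressed on the whole space.\<close>

locale skew_form =
  fixes \<omega> :: "'a::real_vector \<Rightarrow> 'a \<Rightarrow> real" and W B :: "'a set"
  assumes lin: "linear (\<omega> x)" and skew: "\<omega> x y = - \<omega> y x"
    and radical: "x \<in> W \<longleftrightarrow> (\<forall>y. \<omega> x y = 0)" and quot_basis: "quot_basis UNIV W B"
begin

lemma lin_left: "linear (\<lambda>x. \<omega> x y)"
proof -
  have "(\<lambda>x. \<omega> x y) = (\<lambda>x. - \<omega> y x)" using skew by blast
  then show ?thesis using linear_compose_neg[OF lin] by simp
qed

lemma subspace_radical: "subspace W"
  by (auto simp: subspace_def radical linear_0[OF lin_left] linear_add[OF lin_left] linear_scale[OF lin_left])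

sublocale quotient_basis UNIV W B
  using quot_basis subspace_radical by unfold_locales auto

lemma radical_right: "w \<in> W \<Longrightarrow> \<omega> x w = 0"
  using radical skew[of x w] by simp

lemma zero_on_basis:
  assumes "\<And>b. b \<in> B \<Longrightarrow> \<omega> x b = 0"
  shows "x \<in> W"
  unfolding radical
proof
  fix y
  let ?s = "\<Sum>b\<in>B. quot_coord W B y b *\<^sub>R b"
  have "\<omega> x (y - ?s) = 0" using quot_coord_spec(2)[OF basis, of y] by (intro radical_right) simp
  moreover have "\<omega> x ?s = 0" using assms by (simp add: linear_sum[OF lin] linear_scale[OF lin])
  ultimately show "\<omega> x y = 0" by (simp add: linear_diff[OF lin])
qed

text \<open>Nondegeneracy makes the map from vectors modulo \<open>W\<close> to functionals
  injective, hence surjective. To use the result on endomorphisms, a functional is encoded in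
  \<open>\<Psi>\<close> as the vector whose coordinates are its values on \<open>B\<close>.\<close>

lemma represent_functional:
  assumes \<xi>: "linear \<xi>" and \<xi>W: "\<And>w. w \<in> W \<Longrightarrow> \<xi> w = 0"
  obtains v where "\<omega> v = \<xi>"
proof -
  define \<Psi> where "\<Psi> y = (\<Sum>b\<in>B. \<omega> y b *\<^sub>R b)" for y
  have "linear \<Psi>" unfolding \<Psi>_def
    by (rule linearI) (simp_all add: linear_add[OF lin_left] linear_scale[OF lin_left] scaleR_add_left sum.distrib scaleR_sum_right)
  moreover have "\<Psi> w \<in> W" if "w \<in> W" for w
    using that radical subspace_0[OF W] by (simp add: \<Psi>_def)
  ultimately have \<Psi>: "preserves \<Psi>" by (auto simp: preserves_def)
  have inj: "y \<in> W" if "\<Psi> y \<in> W" for y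
    using coord_W[OF that] coord_combination[of _ "\<omega> y"] by (intro zero_on_basis) (simp add: \<Psi>_def)
  obtain v where v: "(\<Sum>b\<in>B. \<xi> b *\<^sub>R b) - \<Psi> v \<in> W"
    using injective_imp_surjective[OF \<Psi> inj, of "\<Sum>b\<in>B. \<xi> b *\<^sub>R b"] by auto
  have "(\<Sum>b\<in>B. \<xi> b *\<^sub>R b) - \<Psi> v = (\<Sum>b\<in>B. (\<xi> b - \<omega> v b) *\<^sub>R b)"
    by (simp add: \<Psi>_def scaleR_diff_left sum_subtractf)
  then have vb: "\<xi> b = \<omega> v b" if "b \<in> B" for b
    using coord_W[OF v, of b] coord_combination[OF that, of "\<lambda>b. \<xi> b - \<omega> v b"] by simp
  have "\<omega> v y = \<xi> y" for y
  proof -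
    let ?s = "\<Sum>b\<in>B. quot_coord W B y b *\<^sub>R b"
    have w: "y - ?s \<in> W" using quot_coord_spec(2)[OF basis, of y] by simp
    have "\<omega> v ?s = \<xi> ?s"
      by (simp add: linear_sum[OF lin] linear_scale[OF lin] linear_sum[OF \<xi>] linear_scale[OF \<xi>] vb)
    then show ?thesis
      using radical_right[OF w, of v] \<xi>W[OF w] by (simp add: linear_diff[OF lin] linear_diff[OF \<xi>])
  qed
  then show ?thesis using that by blast
qed

text \<open>Modulo \<open>W\<close>, the adjoint of \<open>f\<close> with respect to \<open>\<omega>\<close> is \<open>1 - f\<close>, and it has the same trace as \<open>f\<close>.\<close>

lemma trace_conformal:
  assumes f: "linear f" and conf: "\<And>x y. \<omega> (f x) y + \<omega> x (f y) = \<omega> x y"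
  shows "2 * quot_trace f UNIV W = real (card B)"
proof -
  \<comment> \<open>The basis dual to \<open>B\<close> with respect to \<omega>. The represented
    functional is minus a coordinate because \<open>represent_functional\<close> puts the vector on
    the left, while here it stands on the right.\<close>
  have "\<exists>v. \<forall>c\<in>B. \<omega> c v = (if c = b then 1 else 0)" if b: "b \<in> B" for b
  proof -
    have "linear (\<lambda>y. - quot_coord W B y b)"
      by (rule linearI) (simp_all add: coord_add coord_scale)
    then obtain v where v: "\<omega> v = (\<lambda>y. - quot_coord W B y b)"
      by (rule represent_functional) (simp add: coord_W)
    then show ?thesis using skew[of _ v] by (intro exI[of _ v]) (simp add: coord_basis)
  qed
  then have "\<exists>d. \<forall>b\<in>B. \<forall>c\<in>B. \<omega> c (d b) = (if c = b then 1 else 0)"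
    by (intro bchoice ballI)
  then obtain d where d: "\<And>b c. b \<in> B \<Longrightarrow> c \<in> B \<Longrightarrow> \<omega> c (d b) = (if c = b then 1 else 0)" by blast
  have inj: "inj_on d B"
  proof (rule inj_onI)
    fix b c assume "b \<in> B" "c \<in> B" "d b = d c"
    then show "b = c" using d[of b c] d[of c c] by (metis zero_neq_one)
  qed
  have dsum: "\<omega> b (\<Sum>x\<in>d ` B. u x *\<^sub>R x) = u (d b)" if b: "b \<in> B" for u b
  proof -
    have "\<omega> b (\<Sum>x\<in>d ` B. u x *\<^sub>R x) = (\<Sum>c\<in>B. u (d c) * \<omega> b (d c))"
      by (simp add: sum.reindex[OF inj] linear_sum[OF lin] linear_scale[OF lin])
    also have "\<dots> = (\<Sum>c\<in>B. if b = c then u (d b) else 0)"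
      by (rule sum.cong) (auto simp: d b)
    finally show ?thesis using b finite_B by simp
  qed
  have in_W: "v \<in> W" if "\<And>b. b \<in> B \<Longrightarrow> \<omega> b v = 0" for v
    using that skew[of v] by (intro zero_on_basis) simp
  let ?co = "\<lambda>v x. if x \<in> d ` B then \<omega> (the_inv_into B d x) v else 0"
  have co: "?co v (d b) = \<omega> b v" if "b \<in> B" for v b using that by (simp add: the_inv_into_f_f[OF inj])
  have spec: "v - (\<Sum>x\<in>d ` B. ?co v x *\<^sub>R x) \<in> W" for v
    by (rule in_W) (simp add: linear_diff[OF lin] dsum the_inv_into_f_f[OF inj])
  have dB: "quot_basis UNIV W (d ` B)"
    unfolding quot_basis_def
  proof (intro conjI ballI ex_ex1I)
    fix v
    show "\<exists>c. (\<forall>b. b \<notin> d ` B \<longrightarrow> c b = 0) \<and> v - (\<Sum>b\<in>d ` B. c b *\<^sub>R b) \<in> W"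
      using spec[of v] by (intro exI[of _ "?co v"]) simp
    have uniq: "c (d b) = \<omega> b v" if "v - (\<Sum>b\<in>d ` B. c b *\<^sub>R b) \<in> W" "b \<in> B" for c b
      using radical_right[OF that(1), of b] dsum[OF that(2), of c] by (simp add: linear_diff[OF lin])
    fix c c' assume "(\<forall>b. b \<notin> d ` B \<longrightarrow> c b = 0) \<and> v - (\<Sum>b\<in>d ` B. c b *\<^sub>R b) \<in> W"
      "(\<forall>b. b \<notin> d ` B \<longrightarrow> c' b = 0) \<and> v - (\<Sum>b\<in>d ` B. c' b *\<^sub>R b) \<in> W"
    then have "c x = c' x" for x using uniq[of c] uniq[of c'] by (cases "x \<in> d ` B") auto
    then show "c = c'" by (rule ext)
  qed (use finite_B in auto)
  have fW: "f ` W \<subseteq> W" using conf radical by (metis (no_types, lifting) add.right_neutral image_subsetI)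
  have coord_d: "quot_coord W (d ` B) v (d b) = \<omega> b v" if "b \<in> B" for v b
  proof -
    have "quot_coord W (d ` B) v = ?co v" by (rule quot_coord_unique[OF dB _ _ spec]) auto
    then show ?thesis using co[OF that] by simp
  qed
  have coord_B: "quot_coord W B v b = \<omega> v (d b)" if "b \<in> B" for v b
  proof -
    let ?s = "\<Sum>c\<in>B. quot_coord W B v c *\<^sub>R c"
    have w: "v - ?s \<in> W" using quot_coord_spec(2)[OF basis, of v] by simp
    have "\<omega> ?s (d b) = (\<Sum>c\<in>B. if c = b then quot_coord W B v b else 0)"
      unfolding linear_sum[OF lin_left] linear_scale[OF lin_left]
      by (rule sum.cong) (auto simp: d that)
    then show ?thesis using w that finite_B radical by (simp add: linear_diff[OF lin_left])
  qed
  \<comment> \<open>The trace is computed once in \<open>B\<close> and once in the dual basis. By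
    \<open>conf\<close> the two expressions add up to the sum of the pairings of \<open>b\<close>
    with \<open>d b\<close>, each equal to 1.\<close>
  have "quot_trace f UNIV W = (\<Sum>b\<in>B. \<omega> (f b) (d b))"
    unfolding quot_trace_eq[OF quot_basis subspace_UNIV W subset_UNIV f subset_UNIV fW] basis_trace_def
    by (rule sum.cong) (simp_all add: coord_B)
  moreover have "quot_trace f UNIV W = (\<Sum>b\<in>B. \<omega> b (f (d b)))"
    unfolding quot_trace_eq[OF dB subspace_UNIV W subset_UNIV f subset_UNIV fW] basis_trace_def
    by (simp add: sum.reindex[OF inj] coord_d)
  ultimately have "2 * quot_trace f UNIV W = (\<Sum>b\<in>B. \<omega> (f b) (d b) + \<omega> b (f (d b)))"
    by (simp add: sum.distrib)
  also have "\<dots> = real (card B)" by (simp add: conf d)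
  finally show ?thesis .
qed

end

section \<open>Solvable Lie algebras\<close>

locale finite_dim_lie_algebra =
  fixes br :: "'a::real_vector \<Rightarrow> 'a \<Rightarrow> 'a" and S :: "'a set"
  assumes lie: "lie_algebra br" and finite_S: "finite S" and span_S: "span S = UNIV"
begin

lemma linear_ad: "linear (br x)" and linear_br_left: "linear (\<lambda>x. br x y)"
  using lie by (auto simp: lie_algebra_def bilinear_def)

lemmas br_right = linear_add[OF linear_ad] linear_diff[OF linear_ad] linear_scale[OF linear_ad]
  linear_0[OF linear_ad] linear_neg[OF linear_ad]
lemmas br_left = linear_add[OF linear_br_left] linear_diff[OF linear_br_left] linear_scale[OF linear_br_left]
  linear_0[OF linear_br_left] linear_neg[OF linear_br_left]

lemma br_self: "br x x = 0"
  using lie by (simp add: lie_algebra_def)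

lemma br_swap: "br x y = - br y x"
proof -
  have "br (x + y) (x + y) = br y x + br x y"
    unfolding linear_add[OF linear_ad] linear_add[OF linear_br_left] by (simp add: br_self)
  then have "br y x + br x y = 0" unfolding br_self by (rule sym)
  then show ?thesis by (simp only: add_eq_0_iff)
qed

lemma br_br_left: "br (br x y) z = br x (br y z) - br y (br x z)"
proof -
  have "br x (br y z) + br y (br z x) + br z (br x y) = 0"
    using lie by (simp add: lie_algebra_def)
  moreover have "br y (br z x) = - br y (br x z)" using br_swap[of z x] by (simp add: br_right)
  ultimately show ?thesis using br_swap[of z "br x y"] by simp
qed

lemma ideal_subspace: "lie_ideal br I \<Longrightarrow> subspace I"
  by (simp add: lie_ideal_def)

lemma ideal_br: "lie_ideal br I \<Longrightarrow> y \<in> I \<Longrightarrow> br x y \<in> I"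
  by (simp add: lie_ideal_def)

lemma ideal_br_left: "lie_ideal br I \<Longrightarrow> x \<in> I \<Longrightarrow> br x y \<in> I"
  using br_swap[of x y] by (simp add: lie_ideal_def subspace_neg)

lemma bracket_span_base: "a \<in> A \<Longrightarrow> b \<in> B \<Longrightarrow> br a b \<in> bracket_span br A B"
  unfolding bracket_span_def by (intro span_base) blast

lemma bracket_span_least:
  "subspace T \<Longrightarrow> (\<And>a b. a \<in> A \<Longrightarrow> b \<in> B \<Longrightarrow> br a b \<in> T) \<Longrightarrow> bracket_span br A B \<subseteq> T"
  unfolding bracket_span_def by (intro span_minimal) auto

lemma subspace_bracket_span: "subspace (bracket_span br A B)"
  unfolding bracket_span_def by simp

lemma bracket_span_ideal:
  assumes "lie_ideal br I" "lie_ideal br J"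
  shows "lie_ideal br (bracket_span br I J)"
  unfolding lie_ideal_def
proof (intro conjI allI)
  let ?T = "bracket_span br I J"
  show "subspace ?T" by (rule subspace_bracket_span)
  fix x
  have "subspace {y. br x y \<in> ?T}"
    using subspace_bracket_span[of I J] by (auto simp: subspace_def br_right)
  moreover have "br x (br a b) \<in> ?T" if "a \<in> I" "b \<in> J" for a b
  proof -
    have "br x (br a b) = br (br x a) b + br a (br x b)" using br_br_left[of x a b] by simp
    then show ?thesis
      using that assms by (auto intro!: subspace_add[OF subspace_bracket_span] bracket_span_base intro: ideal_br)
  qed
  ultimately have "?T \<subseteq> {y. br x y \<in> ?T}" by (intro bracket_span_least) auto
  then show "\<forall>y\<in>?T. br x y \<in> ?T" by auto
qed

lemma ideal_UNIV: "lie_ideal br UNIV"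
  by (simp add: lie_ideal_def)

lemma derived_ideal: "lie_ideal br (derived_series br i)"
  by (induction i) (auto intro: bracket_span_ideal ideal_UNIV)

lemma central_ideal: "lie_ideal br N \<Longrightarrow> lie_ideal br (central_series br N i)"
  by (induction i) (auto intro: bracket_span_ideal)

lemma derived_Suc_subset: "derived_series br (Suc i) \<subseteq> derived_series br i"
  unfolding derived_series.simps
  by (intro bracket_span_least ideal_subspace[OF derived_ideal] ideal_br[OF derived_ideal])

lemma central_Suc_subset:
  assumes "lie_ideal br N"
  shows "central_series br N (Suc i) \<subseteq> central_series br N i"
  unfolding central_series.simps
  by (intro bracket_span_least ideal_subspace[OF central_ideal] ideal_br[OF central_ideal] assms)

lemma dim_strict: "subspace (U :: 'a set) \<Longrightarrow> U \<subset> V \<Longrightarrow> dim U < dim V"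
  by (rule dim_psubset_less[OF finite_S]) (auto simp: span_S)

end

section \<open>Chief factors: irreducible quotients K/W under the adjoint action\<close>

locale chief_factor = finite_dim_lie_algebra br S for br :: "'a::real_vector \<Rightarrow> 'a \<Rightarrow> 'a" and S +
  fixes K W B
  assumes K_ideal: "lie_ideal br K" and W_ideal: "lie_ideal br W" and WK: "W \<subset> K"
    and maximal: "\<And>U. lie_ideal br U \<Longrightarrow> W \<subset> U \<Longrightarrow> U \<subseteq> K \<Longrightarrow> U = K"
    and quot_basis: "quot_basis K W B"
begin

sublocale quotient_basis K W B
  using quot_basis K_ideal W_ideal WK by unfold_locales (auto simp: lie_ideal_def)

definition trivial_on :: "'a set \<Rightarrow> bool"
  where "trivial_on A \<longleftrightarrow> (\<forall>x\<in>A. \<forall>v\<in>K. br x v \<in> W)"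

lemma trivial_onD: "trivial_on A \<Longrightarrow> x \<in> A \<Longrightarrow> v \<in> K \<Longrightarrow> br x v \<in> W"
  by (simp add: trivial_on_def)

lemma preserves_ad: "preserves (br x)"
  using linear_ad ideal_br K_ideal W_ideal by (auto simp: preserves_def)

lemma br_K: "v \<in> K \<Longrightarrow> br x v \<in> K" and br_W: "v \<in> W \<Longrightarrow> br x v \<in> W"
  using ideal_br K_ideal W_ideal by auto

lemma pow_K: "v \<in> K \<Longrightarrow> (br x ^^ m) v \<in> K"
  by (induction m) (auto intro: br_K)

lemma pow_commute:
  assumes wz: "\<And>v. v \<in> K \<Longrightarrow> br (br w z) v \<in> W" and v: "v \<in> K"
  shows "br w ((br z ^^ m) v) - (br z ^^ m) (br w v) \<in> W"
proof (induction m)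
  case 0
  then show ?case using W by (simp add: subspace_0)
next
  case (Suc m)
  have "br w ((br z ^^ Suc m) v) - (br z ^^ Suc m) (br w v)
    = br (br w z) ((br z ^^ m) v) + br z (br w ((br z ^^ m) v) - (br z ^^ m) (br w v))"
    by (simp add: br_br_left br_right)
  also have "\<dots> \<in> W" by (intro subspace_add[OF W] wz br_W pow_K v Suc)
  finally show ?case .
qed

text \<open>With capitals for the operators on K/W, tr(W V Z^m) = tr(V Z^m W) = tr(V W Z^m): the
  trace is cyclic, and W commutes with Z because [w, z] acts trivially. Hence tr([V, W] Z^m) =
  0.\<close>

lemma tr_commutator_pow:
  assumes wz: "\<And>v. v \<in> K \<Longrightarrow> br (br w z) v \<in> W"
  shows "tr (\<lambda>u. br (br v w) ((br z ^^ m) u)) = 0"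
proof -
  have pm: "preserves (\<lambda>u. br v ((br z ^^ m) u))"
    using preserves_comp preserves_ad preserves_pow by blast
  have "tr (\<lambda>u. br w (br v ((br z ^^ m) u))) = tr (\<lambda>u. br v ((br z ^^ m) (br w u)))"
    using tr_comm[OF preserves_ad[of w] pm] by simp
  also have "\<dots> = tr (\<lambda>u. br v (br w ((br z ^^ m) u)))"
  proof (rule tr_cong)
    show "(\<lambda>u. br v ((br z ^^ m) (br w u))) ` K \<subseteq> K" by (auto intro: br_K pow_K)
    fix u assume u: "u \<in> K"
    have "- br v (br w ((br z ^^ m) u) - (br z ^^ m) (br w u)) \<in> W"
      by (intro subspace_neg[OF W] br_W pow_commute wz u)
    then show "br v ((br z ^^ m) (br w u)) - br v (br w ((br z ^^ m) u)) \<in> W"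
      by (simp add: br_right)
  qed
  finally show ?thesis unfolding br_br_left
    by (subst tr_diff) (auto intro: br_K pow_K)
qed

lemma tr_span_pow:
  assumes G: "\<And>g. g \<in> G \<Longrightarrow> \<exists>v w. g = br v w \<and> (\<forall>u\<in>K. br (br w z) u \<in> W)" and y: "y \<in> span G"
  shows "tr (\<lambda>u. br y ((br z ^^ m) u)) = 0"
proof -
  have "subspace {y. tr (\<lambda>u. br y ((br z ^^ m) u)) = 0}"
    unfolding subspace_def br_left
    by (auto simp: br_left tr_add tr_scale tr_0 subspace_0[OF W] image_subset_iff br_K pow_K)
  moreover have "G \<subseteq> {y. tr (\<lambda>u. br y ((br z ^^ m) u)) = 0}"
    using G tr_commutator_pow by fastforce
  ultimately show ?thesis using span_minimal y by blast
qed

text \<open>As \<open>z\<close> is itself a combination of such brackets, \<open>tr_span_pow\<close>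
  with \<open>y = z\<close> says that every positive power of \<open>br z\<close> is traceless on
  K/W.\<close>

lemma singular:
  assumes G: "\<And>g. g \<in> G \<Longrightarrow> \<exists>v w. g = br v w \<and> (\<forall>u\<in>K. br (br w z) u \<in> W)" and z: "z \<in> span G"
  obtains v where "v \<in> K" "v \<notin> W" "br z v \<in> W"
proof (rule traceless_powers_singular[OF preserves_ad[of z]])
  fix m :: nat assume "1 \<le> m"
  then obtain k where m: "m = Suc k" by (cases m) auto
  show "tr (br z ^^ m) = 0" using tr_span_pow[OF G z, of k] by (simp add: m o_def)
qed (use WK in auto)

text \<open>Write \<open>a\<close> for this derived algebra; its elements commute on \<open>K / W\<close>. The elements of \<open>c = [g, a]\<close> have powers of
  trace zero, so they are singular, their generalized kernels are ideals, and by irreducibility they are nilpotent.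
  Being commuting nilpotents, they have a common kernel, which is again an ideal, so \<open>c\<close> acts trivially. Now \<open>a\<close> acts
  by commutators that are central, hence also by singular operators, whose kernels are ideals.\<close>

lemma derived_step:
  assumes triv: "trivial_on (derived_series br (Suc (Suc k)))"
  shows "trivial_on (derived_series br (Suc k))"
proof -
  let ?a = "derived_series br (Suc k)"
  define c where "c = bracket_span br UNIV ?a"
  have aI: "lie_ideal br ?a" by (rule derived_ideal)
  have cI: "lie_ideal br c" unfolding c_def by (intro bracket_span_ideal ideal_UNIV aI)
  have ca: "c \<subseteq> ?a" unfolding c_def
    by (intro bracket_span_least ideal_subspace[OF aI] ideal_br[OF aI])
  have aa: "br (br x y) v \<in> W" if "x \<in> ?a" "y \<in> ?a" "v \<in> K" for x y v
    using trivial_onD[OF triv _ that(3)] bracket_span_base[OF that(1,2)] by simp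
  have nilp: "\<exists>N. (br z ^^ N) v \<in> W" if z: "z \<in> c" and v: "v \<in> K" for z v
  proof -
    let ?G = "{v \<in> K. \<exists>N. (br z ^^ N) v \<in> W}"
    have za: "z \<in> ?a" using z ca by auto
    obtain v0 where v0: "v0 \<in> K" "v0 \<notin> W" "br z v0 \<in> W"
    proof (rule singular)
      show "z \<in> span {br a b | a b. a \<in> UNIV \<and> b \<in> ?a}" using z by (simp add: c_def bracket_span_def)
      show "\<exists>v w. g = br v w \<and> (\<forall>u\<in>K. br (br w z) u \<in> W)"
        if "g \<in> {br a b | a b. a \<in> UNIV \<and> b \<in> ?a}" for g
        using that aa[OF _ za] by blast
    qed
    have mono: "(br z ^^ (M + N)) v \<in> W" if "(br z ^^ N) v \<in> W" for M N v
      using that by (induction M) (auto intro: br_W)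
    have lin: "linear (br z ^^ N)" for N using preserves_pow[OF preserves_ad] by (auto simp: preserves_def)
    have "subspace ?G"
      unfolding subspace_def
    proof (intro conjI ballI allI)
      show "0 \<in> ?G" using V W by (auto simp: subspace_0 intro!: exI[of _ 0])
      fix x y assume xy: "x \<in> ?G" "y \<in> ?G"
      then obtain M N where "(br z ^^ M) x \<in> W" "(br z ^^ N) y \<in> W" by auto
      then have "(br z ^^ (M + N)) (x + y) \<in> W"
        using mono[of N y M] mono[of M x N] W by (simp add: linear_add[OF lin] subspace_add add.commute)
      then show "x + y \<in> ?G" using xy V by (auto simp: subspace_add)
    next
      fix r x assume x: "x \<in> ?G"
      then obtain M where "(br z ^^ M) x \<in> W" by auto
      then have "(br z ^^ M) (r *\<^sub>R x) \<in> W" using W by (simp add: linear_scale[OF lin] subspace_scale)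
      then show "r *\<^sub>R x \<in> ?G" using x V by (auto simp: subspace_scale)
    qed
    \<comment> \<open>One extra power suffices: z(uv) = u(zv) + [z, u]v, where the induction
      hypothesis applies to zv, while [z, u] lies in \<open>?a\<close> and so commutes with
      \<open>z\<close> modulo \<open>W\<close>.\<close>
    moreover have step: "(br z ^^ Suc N) (br u v) \<in> W" if "v \<in> K" "(br z ^^ N) v \<in> W" for u v N
      using that
    proof (induction N arbitrary: v)
      case 0
      then show ?case by (auto intro: br_W)
    next
      case (Suc N)
      have y: "br z u \<in> ?a" using ideal_br_left[OF aI za] .
      have 1: "(br z ^^ Suc N) (br u (br z v)) \<in> W"
        using Suc.IH[of "br z v"] Suc.prems by (simp add: br_K funpow_swap1)
      have 2: "(br z ^^ Suc N) (br (br z u) v) \<in> W"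
        using subspace_diff[OF W br_W[OF Suc.prems(2)] pow_commute[OF aa[OF y za] Suc.prems(1)], of "br z u" "Suc N"]
        by (simp only: diff_diff_eq2 add_diff_cancel_left')
      have "(br z ^^ Suc (Suc N)) (br u v) = (br z ^^ Suc N) (br z (br u v))"
        by (simp add: funpow_swap1)
      also have "br z (br u v) = br u (br z v) + br (br z u) v" by (simp add: br_br_left)
      also have "(br z ^^ Suc N) \<dots> = (br z ^^ Suc N) (br u (br z v)) + (br z ^^ Suc N) (br (br z u) v)"
        by (rule linear_add[OF lin])
      finally show ?case using 1 2 W by (simp only: subspace_add)
    qed
    ultimately have "lie_ideal br ?G" unfolding lie_ideal_def by (auto intro: br_K dest: step)
    moreover have "W \<subset> ?G"
    proof
      show "W \<subseteq> ?G" using WK by (auto intro!: exI[of _ 0])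
      have "v0 \<in> ?G" using v0 by (auto intro!: exI[of _ 1])
      then show "W \<noteq> ?G" using v0 by auto
    qed
    ultimately have "?G = K" by (rule maximal) auto
    then show ?thesis using v by auto
  qed
  have c_trivial: "trivial_on c"
  proof -
    \<comment> \<open>The nonzero \<open>c\<close>-invariant subspaces of K/W. On one of minimal
      dimension, each \<open>z\<close> in \<open>c\<close> has a nonzero kernel by nilpotency,
      invariant since \<open>c\<close> acts by commuting operators; by minimality this kernel is
      everything.\<close>
    define P where "P T \<longleftrightarrow> subspace T \<and> W \<subset> T \<and> T \<subseteq> K \<and> (\<forall>z\<in>c. \<forall>v\<in>T. br z v \<in> T)" for T
    have "P K" using V WK br_K by (auto simp: P_def)
    then obtain T where T: "P T" and Tmin: "\<And>T'. P T' \<Longrightarrow> dim T \<le> dim T'"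
      using ex_has_least_nat[of P K dim] by blast
    have sub: "br z v \<in> W" if z: "z \<in> c" and v: "v \<in> T" for z v
    proof -
      let ?T = "{v \<in> T. br z v \<in> W}"
      have "P ?T"
        unfolding P_def
      proof (intro conjI ballI)
        show "subspace ?T" using T W by (auto simp: P_def subspace_def br_right)
        show "?T \<subseteq> K" using T by (auto simp: P_def)
        show "W \<subset> ?T"
        proof
          show "W \<subseteq> ?T" using T br_W by (auto simp: P_def)
          obtain v0 where v0: "v0 \<in> T" "v0 \<notin> W" using T by (auto simp: P_def)
          \<comment> \<open>The last iterate of \<open>v0\<close> still outside \<open>W\<close>
            lies in the kernel of \<open>br z\<close> modulo \<open>W\<close>.\<close>
          define N where "N = (LEAST N. (br z ^^ N) v0 \<in> W)"
          have ex: "\<exists>N. (br z ^^ N) v0 \<in> W" using nilp[OF z] v0 T by (auto simp: P_def)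
          have N: "(br z ^^ N) v0 \<in> W" unfolding N_def by (rule LeastI_ex[OF ex])
          then obtain M where M: "N = Suc M" using v0 by (cases N) auto
          then have "(br z ^^ M) v0 \<notin> W" using not_less_Least[of M "\<lambda>N. (br z ^^ N) v0 \<in> W"] by (simp add: N_def)
          moreover have "(br z ^^ m) v0 \<in> T" for m using T z v0 by (induction m) (auto simp: P_def)
          ultimately show "W \<noteq> ?T" using N M by auto
        qed
        fix z' v assume z': "z' \<in> c" and v: "v \<in> ?T"
        have "br z (br z' v) = br (br z z') v + br z' (br z v)" by (simp add: br_br_left)
        moreover have "br (br z z') v \<in> W"
        proof (rule aa)
          show "z \<in> ?a" "z' \<in> ?a" using ca z z' by auto
          show "v \<in> K" using v T by (auto simp: P_def)
        qed
        ultimately show "br z' v \<in> ?T"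
          using v z' T W br_W by (auto simp: P_def subspace_add)
      qed
      then have "\<not> dim ?T < dim T" using Tmin by fastforce
      moreover have "subspace ?T" using \<open>P ?T\<close> by (simp add: P_def)
      ultimately have "?T = T" using dim_strict[of ?T T] by blast
      then show ?thesis using v by auto
    qed
    let ?U = "{v \<in> K. \<forall>z\<in>c. br z v \<in> W}"
    have "lie_ideal br ?U"
      unfolding lie_ideal_def
    proof (intro conjI allI ballI)
      show "subspace ?U" using V W by (auto simp: subspace_def br_right)
      fix x v assume v: "v \<in> ?U"
      have "br z (br x v) \<in> W" if z: "z \<in> c" for z
      proof -
        have "br z (br x v) = br (br z x) v + br x (br z v)" by (simp add: br_br_left)
        then show ?thesis using v z W ideal_br_left[OF cI z] br_W by (simp add: subspace_add)
      qed
      then show "br x v \<in> ?U" using v br_K by auto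
    qed
    moreover have "W \<subset> ?U"
    proof
      show "W \<subseteq> ?U" using WK br_W by auto
      obtain v0 where "v0 \<in> T" "v0 \<notin> W" "T \<subseteq> K" using T by (auto simp: P_def)
      then show "W \<noteq> ?U" using sub by auto
    qed
    ultimately have "?U = K" by (rule maximal) auto
    then show ?thesis by (auto simp: trivial_on_def)
  qed
  have ac: "br x y \<in> c" if "x \<in> ?a" for x y
    using bracket_span_base[of y UNIV x ?a] that br_swap[of x y] ideal_subspace[OF cI]
    by (simp add: c_def subspace_neg)
  show ?thesis
    unfolding trivial_on_def
  proof (intro ballI)
    fix x v assume x: "x \<in> ?a" and v: "v \<in> K"
    let ?U = "{v \<in> K. br x v \<in> W}"
    let ?b = "derived_series br k"
    obtain v0 where v0: "v0 \<in> K" "v0 \<notin> W" "br x v0 \<in> W"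
    proof (rule singular)
      show "x \<in> span {br a b | a b. a \<in> ?b \<and> b \<in> ?b}" using x by (simp add: bracket_span_def)
      have "br (br w x) u \<in> W" if "u \<in> K" for w u
        using trivial_onD[OF c_trivial _ that] bracket_span_base[of w UNIV x ?a] x by (simp add: c_def)
      then show "\<exists>v w. g = br v w \<and> (\<forall>u\<in>K. br (br w x) u \<in> W)"
        if "g \<in> {br a b | a b. a \<in> ?b \<and> b \<in> ?b}" for g
        using that by blast
    qed
    have "lie_ideal br ?U"
      unfolding lie_ideal_def
    proof (intro conjI allI ballI)
      show "subspace ?U" using V W by (auto simp: subspace_def br_right)
      fix y v assume v: "v \<in> ?U"
      have "br x (br y v) = br (br x y) v + br y (br x v)" by (simp add: br_br_left)
      then show "br y v \<in> ?U"
        using v W trivial_onD[OF c_trivial ac[OF x]] br_W br_K by (auto simp: subspace_add)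
    qed
    moreover have "W \<subset> ?U" using WK br_W v0 by auto
    ultimately have "?U = K" by (rule maximal) auto
    then show "br x v \<in> W" using v by auto
  qed
qed

text \<open>Descending induction along the derived series. It ends at index 1, since the term of
  index 0 is the whole algebra, which need not be spanned by brackets.\<close>

lemma derived_trivial:
  assumes "solvable br"
  shows "trivial_on (derived_series br 1)"
proof -
  obtain i where i: "derived_series br i = {0}" using assms by (auto simp: solvable_def)
  \<comment> \<open>\<open>derived_step\<close> concerns successor indices only, so the induction
    starts one term after the one known to vanish.\<close>
  have "derived_series br (Suc i) \<subseteq> {0}" using derived_Suc_subset[of i] i by simp
  then have "trivial_on (derived_series br (Suc i))"
    using W by (auto simp: trivial_on_def br_left subspace_0)
  then have "trivial_on (derived_series br (Suc 0))"
    by (induction i) (auto dest: derived_step simp del: derived_series.simps)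
  then show ?thesis by simp
qed

end

section \<open>Nilpotency of the derived algebra and the nilradical\<close>

context finite_dim_lie_algebra begin

text \<open>Otherwise the derived algebra would act trivially on the top chief factor of \<open>K\<close>.\<close>

lemma perfect_ideal_trivial:
  assumes sol: "solvable br" and K: "lie_ideal br K" "K \<subseteq> bracket_span br (derived_series br 1) K"
  shows "K = {0}"
proof (rule ccontr)
  assume "K \<noteq> {0}"
  let ?P = "\<lambda>W. lie_ideal br W \<and> W \<subset> K"
  have sK: "subspace K" using K by (simp add: lie_ideal_def)
  have "?P {0}" using \<open>K \<noteq> {0}\<close> subspace_0[OF sK] by (auto simp: lie_ideal_def br_right subspace_def)
  moreover have "\<forall>W. ?P W \<longrightarrow> dim W < dim K"
    using dim_strict by (simp add: lie_ideal_def)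
  ultimately have "\<exists>W. ?P W \<and> (\<forall>U. ?P U \<longrightarrow> dim U \<le> dim W)"
    by (rule ex_has_greatest_nat)
  then obtain W where *: "?P W \<and> (\<forall>U. ?P U \<longrightarrow> dim U \<le> dim W)" by (elim exE)
  have WP: "?P W" using * by (rule conjunct1)
  have max: "dim U \<le> dim W" if "?P U" for U using conjunct2[OF *, rule_format, OF that] .
  have sW: "subspace W" using WP by (simp add: lie_ideal_def)
  obtain B where B: "quot_basis K W B"
    using quot_basis_exists[OF sK sW _ finite_S] WP span_S by auto
  interpret chief_factor br S K W B
  proof unfold_locales
    fix U assume U: "lie_ideal br U" "W \<subset> U" "U \<subseteq> K"
    show "U = K"
    proof (rule ccontr)
      assume "U \<noteq> K"
      then have "dim U \<le> dim W" using U by (intro max) auto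
      then show False using dim_strict[OF sW U(2)] by simp
    qed
  qed (use K WP B in auto)
  have "bracket_span br (derived_series br 1) K \<subseteq> W"
    using derived_trivial[OF sol] sW by (intro bracket_span_least) (auto simp: trivial_on_def)
  then show False using K(2) WP by blast
qed

text \<open>A descending series of ideals stabilizes for reasons of dimension, and its stable term
  is equal to its own bracket with the derived algebra, so \<open>perfect_ideal_trivial\<close>
  applies.\<close>

lemma derived_algebra_nilpotent:
  assumes sol: "solvable br"
  shows "\<exists>i. central_series br (derived_series br 1) i = {0}"
proof -
  let ?C = "central_series br (derived_series br 1)"
  have I: "lie_ideal br (?C i)" for i by (intro central_ideal derived_ideal)
  have "\<exists>i. ?C (Suc i) = ?C i"
  proof (rule ccontr)
    assume "\<nexists>i. ?C (Suc i) = ?C i"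
    then have "?C (Suc i) \<subset> ?C i" for i using central_Suc_subset[OF derived_ideal] by blast
    then have less: "dim (?C (Suc i)) < dim (?C i)" for i
      using I by (intro dim_strict) (auto simp: lie_ideal_def simp del: central_series.simps)
    have "dim (?C i) + i \<le> dim (?C 0)" for i
    proof (induction i)
      case (Suc i)
      then show ?case using less[of i] by linarith
    qed simp
    from this[of "Suc (dim (?C 0))"] show False by simp
  qed
  then obtain i where "?C (Suc i) = ?C i" by blast
  then have "?C i = {0}" by (intro perfect_ideal_trivial sol I) simp
  then show ?thesis ..
qed

text \<open>The derived algebra h is a nilpotent ideal. Conversely, let a nilpotent ideal contain
  some v outside h. Then g = Rv + h, so h = [v, h] + [h, h], and by iteration h = (ad v)^k h +
  [h, h] for all k. As ad v is nilpotent, h = [h, h], whence h = 0 by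
  \<open>perfect_ideal_trivial\<close>, against \<open>ne\<close>.\<close>

lemma nilradical_eq_derived:
  assumes sol: "solvable br" and ne: "derived_series br 1 \<noteq> {0}"
    and codim: "\<And>v x. v \<notin> derived_series br 1 \<Longrightarrow> \<exists>r. x - r *\<^sub>R v \<in> derived_series br 1"
  shows "nilradical br = derived_series br 1"
proof -
  let ?h = "derived_series br 1"
  let ?h' = "bracket_span br ?h ?h"
  have hI: "lie_ideal br ?h" by (rule derived_ideal)
  have h'I: "lie_ideal br ?h'" by (intro bracket_span_ideal hI)
  note sh = ideal_subspace[OF hI] and sh' = ideal_subspace[OF h'I]
  have "I \<subseteq> ?h" if I: "nilpotent_ideal br I" for I
  proof (rule ccontr)
    assume "\<not> I \<subseteq> ?h"
    then obtain v where v: "v \<in> I" "v \<notin> ?h" by auto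
    have II: "lie_ideal br I" using I by (simp add: nilpotent_ideal_def)
    obtain n where n: "central_series br I n = {0}" using I by (auto simp: nilpotent_ideal_def)
    have lin: "linear (br v ^^ k)" for k
      by (induction k) (simp_all add: linear_id[unfolded id_def] id_def linear_compose[OF _ linear_ad] del: o_apply)
    \<comment> \<open>The index shift is due to the initial bracket, which only brings an arbitrary
      \<open>y\<close> into \<open>I\<close>, the term of index 0.\<close>
    have pow_C: "(br v ^^ Suc k) y \<in> central_series br I k" for k y
      using v by (induction k) (auto intro: ideal_br_left[OF II] bracket_span_base)
    have pow_h': "(br v ^^ k) y \<in> ?h'" if "y \<in> ?h'" for k y
      using that by (induction k) (simp_all add: ideal_br[OF h'I, simplified])
    let ?T = "{br v y + w | y w. y \<in> ?h \<and> w \<in> ?h'}"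
    have sT: "subspace ?T"
      unfolding subspace_def
    proof (intro conjI ballI allI)
      show "0 \<in> ?T" using subspace_0[OF sh] subspace_0[OF sh']
        by (intro CollectI exI[of _ 0]) (auto simp: br_right)
      fix a b assume "a \<in> ?T" "b \<in> ?T"
      then obtain y w y' w' where "a = br v y + w" "y \<in> ?h" "w \<in> ?h'" "b = br v y' + w'" "y' \<in> ?h" "w' \<in> ?h'"
        by blast
      then show "a + b \<in> ?T" using sh sh'
        by (intro CollectI exI[of _ "y + y'"] exI[of _ "w + w'"]) (simp add: br_right subspace_add del: derived_series.simps)
    next
      fix r a assume "a \<in> ?T"
      then obtain y w where "a = br v y + w" "y \<in> ?h" "w \<in> ?h'" by blast
      then show "r *\<^sub>R a \<in> ?T" using sh sh'
        by (intro CollectI exI[of _ "r *\<^sub>R y"] exI[of _ "r *\<^sub>R w"])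
          (simp add: br_right subspace_scale scaleR_add_right del: derived_series.simps)
    qed
    have "br a b \<in> ?T" for a b
    proof -
      obtain r s where rs: "a - r *\<^sub>R v \<in> ?h" "b - s *\<^sub>R v \<in> ?h" using codim[OF v(2)] by blast
      define a' b' where "a' = a - r *\<^sub>R v" and "b' = b - s *\<^sub>R v"
      have ab: "a = a' + r *\<^sub>R v" "b = b' + s *\<^sub>R v" by (auto simp: a'_def b'_def)
      have "br a b = br v (r *\<^sub>R b' - s *\<^sub>R a') + br a' b'"
        unfolding ab using br_swap[of a' v] by (simp add: br_left br_right br_self)
      moreover have "r *\<^sub>R b' - s *\<^sub>R a' \<in> ?h" "br a' b' \<in> ?h'"
        using rs sh unfolding a'_def b'_def by (auto intro!: subspace_diff subspace_scale bracket_span_base simp del: derived_series.simps)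
      ultimately show ?thesis by blast
    qed
    then have hT: "?h \<subseteq> ?T" using bracket_span_least[OF sT, of UNIV UNIV] by simp
    have "\<exists>y w. y \<in> ?h \<and> w \<in> ?h' \<and> x = (br v ^^ k) y + w" if "x \<in> ?h" for k x
    proof (induction k)
      case 0
      then show ?case using that subspace_0[OF sh'] by (intro exI[of _ x] exI[of _ 0]) simp
    next
      case (Suc k)
      then obtain y w where yw: "y \<in> ?h" "w \<in> ?h'" "x = (br v ^^ k) y + w" by blast
      obtain y' w' where yw': "y' \<in> ?h" "w' \<in> ?h'" "y = br v y' + w'" using hT yw(1) by blast
      have "x = (br v ^^ Suc k) y' + ((br v ^^ k) w' + w)"
        unfolding yw(3) yw'(3) by (simp add: linear_add[OF lin] funpow_swap1)
      moreover have "(br v ^^ k) w' + w \<in> ?h'" using yw yw' pow_h' sh' by (intro subspace_add)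
      ultimately show ?case using yw'(1) by blast
    qed
    from this[of _ "Suc n"] have "?h \<subseteq> ?h'" using pow_C[of n] n by fastforce
    then have "?h = {0}" by (intro perfect_ideal_trivial sol hI)
    then show False using ne by simp
  qed
  moreover have "nilpotent_ideal br ?h"
    unfolding nilpotent_ideal_def using derived_algebra_nilpotent[OF sol] hI by simp
  ultimately show ?thesis
    unfolding nilradical_def using sh
    by (intro subset_antisym span_minimal) (auto simp del: derived_series.simps intro!: span_base)
qed

end

section \<open>Alternating forms\<close>

lemma forms_length: "\<omega> \<in> forms k \<Longrightarrow> length xs \<noteq> k \<Longrightarrow> \<omega> xs = 0"
  by (simp add: forms_def)

lemma forms_linear: "\<omega> \<in> forms k \<Longrightarrow> length xs = k \<Longrightarrow> i < k \<Longrightarrow> linear (\<lambda>x. \<omega> (xs[i := x]))"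
  by (simp add: forms_def)

lemma forms_eq_entries:
  assumes "\<omega> \<in> forms k" "i < k" "j < k" "i \<noteq> j" "xs ! i = xs ! j"
  shows "\<omega> xs = 0"
proof (cases "length xs = k")
  case True
  have "\<omega> xs = 0" if "i < j" "j < k" "xs ! i = xs ! j" for i j
    using assms(1) True that unfolding forms_def by blast
  then show ?thesis using assms by (metis linorder_neqE_nat)
qed (use assms in \<open>simp add: forms_length\<close>)

lemma forms_swap:
  assumes \<omega>: "\<omega> \<in> forms k" and ij: "length xs = k" "i < k" "j < k" "i \<noteq> j"
  shows "\<omega> (xs[i := u, j := v]) = - \<omega> (xs[i := v, j := u])"
proof -
  have add: "\<omega> (ys[l := a + b]) = \<omega> (ys[l := a]) + \<omega> (ys[l := b])" if "length ys = k" "l < k" for ys l a b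
    using linear_add[OF forms_linear[OF \<omega> that]] .
  have eq: "\<omega> (xs[i := a, j := a]) = 0" for a
    by (rule forms_eq_entries[OF \<omega> ij(2,3,4)]) (use ij in simp)
  have sw: "xs[i := a, j := b] = xs[j := b, i := a]" for a b
    by (rule list_update_swap) (rule ij(4))
  have "0 = \<omega> (xs[i := u + v, j := u + v])" by (simp add: eq)
  also have "\<dots> = \<omega> (xs[i := u + v, j := u]) + \<omega> (xs[i := u + v, j := v])"
    using ij by (intro add) auto
  also have "\<omega> (xs[i := u + v, j := u]) = \<omega> (xs[i := u, j := u]) + \<omega> (xs[i := v, j := u])"
    unfolding sw using ij by (intro add) auto
  also have "\<omega> (xs[i := u + v, j := v]) = \<omega> (xs[i := u, j := v]) + \<omega> (xs[i := v, j := v])"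
    unfolding sw using ij by (intro add) auto
  finally show ?thesis by (simp add: eq)
qed

lemma forms_nonzero_independent:
  assumes \<omega>: "\<omega> \<in> forms k" and nz: "\<omega> xs \<noteq> 0"
  shows "distinct xs" "independent (set xs)"
proof -
  have len: "length xs = k" using forms_length[OF \<omega>] nz by blast
  show "distinct xs"
    unfolding distinct_conv_nth using forms_eq_entries[OF \<omega>, of _ _ xs] nz len by blast
  show "independent (set xs)"
  proof
    assume "dependent (set xs)"
    then obtain v where v: "v \<in> set xs" "v \<in> span (set xs - {v})" by (auto simp: dependent_def)
    then obtain i where i: "i < k" "v = xs ! i" using len by (auto simp: in_set_conv_nth)
    have "set xs - {v} \<subseteq> {u. \<omega> (xs[i := u]) = 0}"
    proof
      fix w assume w: "w \<in> set xs - {v}"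
      then obtain j where j: "j < k" "w = xs ! j" using len by (auto simp: in_set_conv_nth)
      then have "i \<noteq> j" using i w by auto
      then have "\<omega> (xs[i := w]) = 0"
        by (intro forms_eq_entries[OF \<omega> i(1) j(1)]) (use i j len in auto)
      then show "w \<in> {u. \<omega> (xs[i := u]) = 0}" by simp
    qed
    moreover have "subspace {u. \<omega> (xs[i := u]) = 0}"
      by (rule linear_subspace_kernel[OF forms_linear[OF \<omega> len i(1)]])
    ultimately have "v \<in> {u. \<omega> (xs[i := u]) = 0}" using span_minimal v(2) by blast
    then show False using nz i by simp
  qed
qed

text \<open>Steinitz exchange, with the form as test for a basis. If c_i are the coordinates of
  \<open>x\<close> in \<open>xs\<close>, replacing entry i by \<open>x\<close> multiplies the value
  of \<omega> by c_i. The positions in \<open>J\<close> are to be kept; a nonzero c_i outside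
  \<open>J\<close> exists because \<open>x\<close> is not in the span of those entries.\<close>

lemma forms_exchange:
  assumes \<omega>: "\<omega> \<in> forms k" and nz: "\<omega> xs \<noteq> 0" and x: "x \<in> span (set xs)" "x \<notin> span ((!) xs ` J)"
  obtains i where "i < k" "i \<notin> J" "\<omega> (xs[i := x]) \<noteq> 0"
proof (rule ccontr)
  assume "\<not> thesis"
  with that have zero: "\<omega> (xs[i := x]) = 0" if "i < k" "i \<notin> J" for i using that by blast
  have len: "length xs = k" using forms_length[OF \<omega>] nz by blast
  note ind = forms_nonzero_independent[OF \<omega> nz]
  obtain c where "x = (\<Sum>v\<in>set xs. c v *\<^sub>R v)" using x(1) by (auto simp: span_finite)
  also have "\<dots> = (\<Sum>i<k. c (xs ! i) *\<^sub>R xs ! i)"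
    by (rule sum.reindex_bij_betw[symmetric])
      (use ind(1) len in \<open>auto intro: bij_betw_nth\<close>)
  finally have x_eq: "x = (\<Sum>i<k. c (xs ! i) *\<^sub>R xs ! i)" .
  have c0: "c (xs ! i) = 0" if i: "i < k" "i \<notin> J" for i
  proof -
    note lin = forms_linear[OF \<omega> len i(1)]
    have "\<omega> (xs[i := x]) = (\<Sum>j<k. c (xs ! j) * \<omega> (xs[i := xs ! j]))"
      unfolding x_eq linear_sum[OF lin] linear_scale[OF lin] by simp
    also have "\<dots> = (\<Sum>j<k. if j = i then c (xs ! i) * \<omega> xs else 0)"
    proof (rule sum.cong[OF refl])
      fix j assume j: "j \<in> {..<k}"
      show "c (xs ! j) * \<omega> (xs[i := xs ! j]) = (if j = i then c (xs ! i) * \<omega> xs else 0)"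
      proof (cases "j = i")
        case False
        then have "\<omega> (xs[i := xs ! j]) = 0"
          by (intro forms_eq_entries[OF \<omega> i(1), of j]) (use j i len in auto)
        then show ?thesis using False by simp
      qed simp
    qed
    also have "\<dots> = c (xs ! i) * \<omega> xs" using i by simp
    finally show ?thesis using zero[OF i] nz by simp
  qed
  have "c (xs ! i) *\<^sub>R xs ! i \<in> span ((!) xs ` J)" if "i < k" for i
    using c0[OF that] by (cases "i \<in> J") (auto intro: span_scale span_base span_zero)
  then have "x \<in> span ((!) xs ` J)" unfolding x_eq by (intro span_sum) auto
  then show False using x(2) by simp
qed

lemma permute_list_update:
  assumes \<sigma>: "\<sigma> permutes {..<length xs}" and i: "i < length xs"
  shows "permute_list \<sigma> (xs[i := x]) = (permute_list \<sigma> xs)[inv \<sigma> i := x]"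
proof (rule nth_equalityI)
  fix j assume "j < length (permute_list \<sigma> (xs[i := x]))"
  then have j: "j < length xs" by simp
  have iff: "inv \<sigma> i = j \<longleftrightarrow> \<sigma> j = i" using permutes_inv_eq[OF \<sigma>] by metis
  have \<sigma>j: "\<sigma> j < length xs" using permutes_in_image[OF \<sigma>, of j] j by simp
  show "permute_list \<sigma> (xs[i := x]) ! j = (permute_list \<sigma> xs)[inv \<sigma> i := x] ! j"
  proof (cases "\<sigma> j = i")
    case True
    then show ?thesis using iff j \<sigma> \<sigma>j by (simp add: permute_list_nth)
  next
    case False
    then show ?thesis using iff j \<sigma> \<sigma>j by (simp add: permute_list_nth)
  qed
qed simp

text \<open>In the summand of \<sigma>, argument i occupies position \<open>inv \<sigma> i\<close>,
  which belongs to exactly one factor; this gives linearity. If arguments i and j agree, composing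
  \<sigma> with their transposition keeps the permuted list and reverses the sign, so the sum is its
  own negative.\<close>

lemma wedge_in_forms:
  assumes a: "\<alpha> \<in> forms p" and b: "\<beta> \<in> forms q"
  shows "wedge p q \<alpha> \<beta> \<in> forms (p + q)"
  unfolding forms_def
proof (intro CollectI conjI allI impI)
  show "wedge p q \<alpha> \<beta> xs = 0" if "length xs \<noteq> p + q" for xs
    using that by (simp add: wedge_def)
next
  fix xs :: "'a list" and i assume len: "length xs = p + q \<and> i < p + q"
  let ?f = "\<lambda>\<sigma> xs. of_int (sign \<sigma>) * \<alpha> (take p (permute_list \<sigma> xs)) * \<beta> (drop p (permute_list \<sigma> xs))"
  have "linear (\<lambda>x. ?f \<sigma> (xs[i := x]))" if \<sigma>: "\<sigma> permutes {..<p + q}" for \<sigma>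
  proof -
    let ?k = "inv \<sigma> i" and ?ys = "permute_list \<sigma> xs"
    have k: "?k < p + q" using permutes_in_image[OF permutes_inv[OF \<sigma>], of i] len by simp
    have upd: "permute_list \<sigma> (xs[i := x]) = ?ys[?k := x]" for x
      using permute_list_update[of \<sigma> xs i x] \<sigma> len by simp
    show ?thesis
    proof (cases "?k < p")
      case True
      then have "(\<lambda>x. ?f \<sigma> (xs[i := x])) = (\<lambda>x. (of_int (sign \<sigma>) * \<beta> (drop p ?ys)) *\<^sub>R \<alpha> ((take p ?ys)[?k := x]))"
        by (simp add: upd take_update_swap fun_eq_iff)
      then show ?thesis
        using linear_compose_scale_right[OF forms_linear[OF a, of "take p ?ys" ?k]] True len by simp
    next
      case False
      then have "(\<lambda>x. ?f \<sigma> (xs[i := x])) = (\<lambda>x. (of_int (sign \<sigma>) * \<alpha> (take p ?ys)) *\<^sub>R \<beta> ((drop p ?ys)[?k - p := x]))"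
        by (simp add: upd drop_update_swap fun_eq_iff)
      then show ?thesis
        using linear_compose_scale_right[OF forms_linear[OF b, of "drop p ?ys" "?k - p"]] False k len by simp
    qed
  qed
  then have "linear (\<lambda>x. (1 / (fact p * fact q)) *\<^sub>R (\<Sum>\<sigma> | \<sigma> permutes {..<p + q}. ?f \<sigma> (xs[i := x])))"
    by (intro linear_compose_scale_right linear_compose_sum) auto
  then show "linear (\<lambda>x. wedge p q \<alpha> \<beta> (xs[i := x]))"
    using len by (simp add: wedge_def)
next
  fix xs :: "'a list" and i j assume "length xs = p + q \<and> i < j \<and> j < p + q \<and> xs ! i = xs ! j"
  then have ij: "length xs = p + q" "i < j" "j < p + q" "xs ! i = xs ! j" by auto
  let ?f = "\<lambda>\<sigma>. of_int (sign \<sigma>) * \<alpha> (take p (permute_list \<sigma> xs)) * \<beta> (drop p (permute_list \<sigma> xs))"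
  let ?\<tau> = "Transposition.transpose i j" and ?P = "{\<sigma>. \<sigma> permutes {..<p + q}}"
  have \<tau>: "?\<tau> permutes {..<p + q}" using ij by (intro permutes_swap_id) auto
  have bij: "bij_betw (\<lambda>\<sigma>. ?\<tau> \<circ> \<sigma>) ?P ?P"
    by (rule bij_betw_byWitness[of _ "\<lambda>\<sigma>. ?\<tau> \<circ> \<sigma>"]) (auto intro: permutes_compose[OF _ \<tau>] simp: comp_assoc[symmetric])
  have neg: "?f (?\<tau> \<circ> \<sigma>) = - ?f \<sigma>" if "\<sigma> permutes {..<p + q}" for \<sigma>
  proof -
    have "sign (?\<tau> \<circ> \<sigma>) = - sign \<sigma>"
      using sign_compose[of ?\<tau> \<sigma>] permutes_imp_permutation[of "{..<p + q}"] \<tau> that ij by (simp add: sign_swap_id)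
    moreover have "xs ! ?\<tau> m = xs ! m" for m using ij by (simp add: Transposition.transpose_def)
    then have "permute_list (?\<tau> \<circ> \<sigma>) xs = permute_list \<sigma> xs" by (simp add: permute_list_def)
    ultimately show ?thesis by simp
  qed
  have "sum ?f ?P = (\<Sum>\<sigma>\<in>?P. ?f (?\<tau> \<circ> \<sigma>))" using sum.reindex_bij_betw[OF bij, of ?f] by simp
  also have "\<dots> = (\<Sum>\<sigma>\<in>?P. - ?f \<sigma>)" by (rule sum.cong[OF refl]) (use neg in simp)
  also have "\<dots> = - sum ?f ?P" by (rule sum_negf)
  finally have "sum ?f ?P = 0" by linarith
  then show "wedge p q \<alpha> \<beta> xs = 0" by (simp add: wedge_def)
qed

text \<open>Each summand distributes the arguments over the two factors. For a vanishing test it is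
  enough to know which arguments occur in which block, so the hypothesis keeps only their
  sets.\<close>

lemma wedge_eq_0:
  assumes "\<And>ys zs. length ys = p \<Longrightarrow> length zs = q \<Longrightarrow> set ys \<union> set zs = set xs \<Longrightarrow> \<alpha> ys = 0 \<or> \<beta> zs = 0"
  shows "wedge p q \<alpha> \<beta> xs = 0"
proof (cases "length xs = p + q")
  case len: True
  have "of_int (sign \<sigma>) * \<alpha> (take p (permute_list \<sigma> xs)) * \<beta> (drop p (permute_list \<sigma> xs)) = 0"
    if "\<sigma> permutes {..<p + q}" for \<sigma>
  proof -
    have "set (take p (permute_list \<sigma> xs)) \<union> set (drop p (permute_list \<sigma> xs)) = set (permute_list \<sigma> xs)"
      by (metis append_take_drop_id set_append)
    also have "\<dots> = set xs" using that len by simp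
    finally show ?thesis using assms[of "take p (permute_list \<sigma> xs)" "drop p (permute_list \<sigma> xs)"] len by auto
  qed
  then have "(\<Sum>\<sigma> | \<sigma> permutes {..<p + q}. of_int (sign \<sigma>) *
             \<alpha> (take p (permute_list \<sigma> xs)) * \<beta> (drop p (permute_list \<sigma> xs))) = 0"
    by (intro sum.neutral) auto
  then show ?thesis by (simp add: wedge_def)
qed (simp add: wedge_def)

lemma contract_in_forms:
  assumes "\<omega> \<in> forms (Suc k)"
  shows "contract v \<omega> \<in> forms k"
  unfolding forms_def contract_def
proof (intro CollectI conjI allI impI)
  show "\<omega> (v # xs) = 0" if "length xs \<noteq> k" for xs
    using forms_length[OF assms] that by simp
  show "linear (\<lambda>x. \<omega> (v # xs[i := x]))" if "length xs = k \<and> i < k" for xs i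
    using forms_linear[OF assms, of "v # xs" "Suc i"] that by simp
  show "\<omega> (v # xs) = 0" if "length xs = k \<and> i < j \<and> j < k \<and> xs ! i = xs ! j" for xs i j
    by (rule forms_eq_entries[OF assms, of "Suc i" "Suc j"]) (use that in auto)
qed

lemma forms_3_swap:
  assumes "\<phi> \<in> forms 3"
  shows "\<phi> [y, x, z] = - \<phi> [x, y, z]" "\<phi> [x, z, y] = - \<phi> [x, y, z]"
  using forms_swap[OF assms, of "[x, y, z]" 0 1 y x] forms_swap[OF assms, of "[x, y, z]" 1 2 z y]
  by (simp_all add: numeral_2_eq_2)

lemma forms_3_linear: "\<phi> \<in> forms 3 \<Longrightarrow> linear (\<lambda>z. \<phi> [x, y, z])"
  using forms_linear[of \<phi> 3 "[x, y, 0]" 2] by (simp add: numeral_2_eq_2)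

section \<open>Low-degree cohomology\<close>

lemma subspace_forms: "subspace (forms k :: ('a::real_vector list \<Rightarrow> real) set)"
  unfolding subspace_def
proof (intro conjI ballI allI)
  show "0 \<in> (forms k :: ('a list \<Rightarrow> real) set)"
    by (simp add: forms_def module_hom_zero)
next
  fix \<alpha> \<beta> :: "'a list \<Rightarrow> real" assume a: "\<alpha> \<in> forms k" and b: "\<beta> \<in> forms k"
  show "\<alpha> + \<beta> \<in> forms k"
    unfolding forms_def
  proof (intro CollectI conjI allI impI)
    show "(\<alpha> + \<beta>) xs = 0" if "length xs \<noteq> k" for xs
      using forms_length[OF a that] forms_length[OF b that] by simp
    show "linear (\<lambda>x. (\<alpha> + \<beta>) (xs[i := x]))" if "length xs = k \<and> i < k" for xs and i :: nat
      using linear_compose_add[OF forms_linear[OF a] forms_linear[OF b], of xs i xs i] that by simp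
    show "(\<alpha> + \<beta>) xs = 0" if "length xs = k \<and> i < j \<and> j < k \<and> xs ! i = xs ! j" for xs i j
      using forms_eq_entries[OF a, of i j xs] forms_eq_entries[OF b, of i j xs] that by simp
  qed
next
  fix r and \<alpha> :: "'a list \<Rightarrow> real" assume a: "\<alpha> \<in> forms k"
  show "r *\<^sub>R \<alpha> \<in> forms k"
    unfolding forms_def
  proof (intro CollectI conjI allI impI)
    show "(r *\<^sub>R \<alpha>) xs = 0" if "length xs \<noteq> k" for xs
      using forms_length[OF a that] by (simp add: scaleR_fun_def)
    show "linear (\<lambda>x. (r *\<^sub>R \<alpha>) (xs[i := x]))" if "length xs = k \<and> i < k" for xs and i :: nat
      using linear_compose_scale_right[OF forms_linear[OF a], of xs i r] that by (simp add: scaleR_fun_def)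
    show "(r *\<^sub>R \<alpha>) xs = 0" if "length xs = k \<and> i < j \<and> j < k \<and> xs ! i = xs ! j" for xs i j
      using forms_eq_entries[OF a, of i j xs] that by (simp add: scaleR_fun_def)
  qed
qed

lemma linear_ce_diff: "linear (ce_diff br)"
  by (rule linearI)
    (simp_all add: fun_eq_iff ce_diff_def scaleR_fun_def distrib_left sum.distrib sum_distrib_left mult_ac)

lemma forms_1_linear: "f \<in> forms 1 \<Longrightarrow> linear (\<lambda>x. f [x])"
  using forms_linear[of f 1 "[0]" 0] by simp

lemma form_2_of_bilinear:
  fixes s :: "'a::real_vector \<Rightarrow> 'a \<Rightarrow> real"
  assumes "\<And>y. linear (\<lambda>x. s x y)" "\<And>x. linear (s x)" "\<And>x. s x x = 0"
  shows "(\<lambda>xs. if length xs = 2 then s (xs ! 0) (xs ! 1) else 0) \<in> forms 2"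
  unfolding forms_def
proof (intro CollectI conjI allI impI)
  fix xs :: "'a list" and i :: nat assume "length xs = 2 \<and> i < 2"
  then show "linear (\<lambda>x. if length (xs[i := x]) = 2 then s (xs[i := x] ! 0) (xs[i := x] ! 1) else 0)"
    using assms by (auto simp: less_2_cases_iff)
next
  fix xs :: "'a list" and i j :: nat assume "length xs = 2 \<and> i < j \<and> j < 2 \<and> xs ! i = xs ! j"
  moreover from this have "i = 0" "j = 1" by auto
  ultimately show "(if length xs = 2 then s (xs ! 0) (xs ! 1) else 0) = 0"
    using assms(3) by simp
qed auto

lemma forms_2_linear:
  assumes "\<alpha> \<in> forms 2"
  shows "linear (\<lambda>x. \<alpha> [x, y])" "linear (\<lambda>y. \<alpha> [x, y])"
  using forms_linear[OF assms, of "[0, y]" 0] forms_linear[OF assms, of "[x, 0]" 1] by simp_all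

lemma forms_2_swap: "\<alpha> \<in> forms 2 \<Longrightarrow> \<alpha> [y, x] = - \<alpha> [x, y]"
  using forms_swap[of \<alpha> 2 "[x, y]" 0 1 y x] by simp

lemma ce_diff_length:
  assumes \<omega>: "\<omega> \<in> forms k" and len: "length xs \<noteq> Suc k"
  shows "ce_diff br \<omega> xs = 0"
proof -
  have "\<omega> (br (xs ! i) (xs ! j) # nths xs (- {i, j})) = 0" if ij: "i < j" "j < length xs" for i j
  proof (rule forms_length[OF \<omega>])
    have "{m. m < length xs \<and> m \<in> - {i, j}} = {..<length xs} - {i, j}" by auto
    then have "length (nths xs (- {i, j})) = length xs - 2"
      using ij by (simp add: length_nths card_Diff_subset)
    then show "length (br (xs ! i) (xs ! j) # nths xs (- {i, j})) \<noteq> k" using len ij by simp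
  qed
  then show ?thesis unfolding ce_diff_def by (intro sum.neutral ballI) simp
qed

lemma length_3_cases:
  assumes "length xs = 3"
  obtains x y z where "xs = [x, y, z]"
  using assms by (auto simp: numeral_3_eq_3 length_Suc_conv)

context finite_dim_lie_algebra begin

text \<open>On 1-forms, d d = 0 is the Jacobi identity under \<open>f\<close>. It provides the
  inclusion of coboundaries in cocycles for the quotient defining b_2.\<close>

lemma ce_diff_forms_1:
  assumes f: "f \<in> forms 1"
  shows "ce_diff br f \<in> cocycles br 2"
proof -
  note lin = forms_1_linear[OF f]
  have eq: "ce_diff br f = (\<lambda>xs. if length xs = 2 then - f [br (xs ! 0) (xs ! 1)] else 0)"
  proof
    fix xs :: "'a list"
    show "ce_diff br f xs = (if length xs = 2 then - f [br (xs ! 0) (xs ! 1)] else 0)"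
    proof (cases "length xs = 2")
      case True
      then obtain x y where "xs = [x, y]" by (auto simp: numeral_2_eq_2 length_Suc_conv)
      then show ?thesis by (simp add: ce_diff_1)
    next
      case False
      then show ?thesis using ce_diff_length[OF f, of xs br] by simp
    qed
  qed
  have form: "ce_diff br f \<in> forms 2"
    unfolding eq
  proof (rule form_2_of_bilinear)
    show "linear (\<lambda>x. - f [br x y])" for y
      using linear_compose_neg[OF linear_compose[OF linear_br_left lin]] by (simp add: o_def)
    show "linear (\<lambda>y. - f [br x y])" for x
      using linear_compose_neg[OF linear_compose[OF linear_ad lin]] by (simp add: o_def)
    show "- f [br x x] = 0" for x using linear_0[OF lin] by (simp add: br_self)
  qed
  have "ce_diff br (ce_diff br f) xs = 0" for xs
  proof (cases "length xs = 3")
    case True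
    then obtain x y z where xs: "xs = [x, y, z]" by (rule length_3_cases)
    have "br (br x y) z - br (br x z) y + br (br y z) x = 0"
      using br_swap[of "br x z" y] br_swap[of "br y z" x] by (simp add: br_br_left)
    then have "f [br (br x y) z] - f [br (br x z) y] + f [br (br y z) x] = 0"
      using linear_0[OF lin] by (metis (no_types, lifting) lin linear_add linear_diff)
    then show ?thesis unfolding xs ce_diff_2 ce_diff_1 by simp
  next
    case False
    then show ?thesis using ce_diff_length[OF form] by simp
  qed
  then show ?thesis using form by (simp add: cocycles_def fun_eq_iff)
qed

text \<open>Finite-dimensionality guarantees that a quotient basis for the second cohomology exists,
  so that \<open>betti br 2 = 0\<close> can be turned into an inclusion. The products of coordinates
  in \<open>E\<close> are not alternating; it is enough that their span contains
  \<open>forms 2\<close>.\<close>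

lemma forms_2_finite_span:
  obtains F :: "('a list \<Rightarrow> real) set" where "finite F" "forms 2 \<subseteq> span F"
proof -
  obtain B :: "'a set" where B: "quot_basis UNIV {0} B"
    using quot_basis_exists[of UNIV "{0}" S] finite_S span_S by auto
  interpret quotient_basis UNIV "{0}" B by unfold_locales (use B in auto)
  define E where "E = (\<lambda>(b, c) xs. if length xs = 2 then quot_coord {0} B (xs ! 0) b * quot_coord {0} B (xs ! 1) c else 0)"
  have expand: "(\<Sum>b\<in>B. quot_coord {0} B x b *\<^sub>R b) = x" for x
    using quot_coord_spec(2)[OF B, of x] by simp
  have sum_apply: "(\<Sum>p\<in>I. g p) xs = (\<Sum>p\<in>I. g p xs)" for g :: "'a \<times> 'a \<Rightarrow> 'a list \<Rightarrow> real" and I xs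
    by (induction I rule: infinite_finite_induct) auto
  have "\<omega> \<in> span (E ` (B \<times> B))" if \<omega>: "\<omega> \<in> forms 2" for \<omega>
  proof -
    note lin = forms_2_linear[OF \<omega>]
    have "\<omega> xs = (\<Sum>(b, c)\<in>B \<times> B. \<omega> [b, c] *\<^sub>R E (b, c)) xs" for xs
    proof (cases "length xs = 2")
      case True
      then obtain x y where xs: "xs = [x, y]" by (auto simp: numeral_2_eq_2 length_Suc_conv)
      have "\<omega> [x, y] = \<omega> [\<Sum>b\<in>B. quot_coord {0} B x b *\<^sub>R b, \<Sum>c\<in>B. quot_coord {0} B y c *\<^sub>R c]"
        by (simp add: expand)
      also have "\<dots> = (\<Sum>b\<in>B. \<Sum>c\<in>B. quot_coord {0} B x b * (quot_coord {0} B y c * \<omega> [b, c]))"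
        unfolding linear_sum[OF lin(1)] linear_scale[OF lin(1)] unfolding linear_sum[OF lin(2)] linear_scale[OF lin(2)]
        by (simp add: sum_distrib_left)
      also have "\<dots> = (\<Sum>(b, c)\<in>B \<times> B. \<omega> [b, c] *\<^sub>R E (b, c)) xs"
        by (simp add: sum_apply sum.cartesian_product case_prod_beta scaleR_fun_def E_def xs mult_ac)
      finally show ?thesis using xs by simp
    next
      case False
      then show ?thesis
        using forms_length[OF \<omega> False] by (simp add: sum_apply case_prod_beta scaleR_fun_def E_def)
    qed
    then have "\<omega> = (\<Sum>(b, c)\<in>B \<times> B. \<omega> [b, c] *\<^sub>R E (b, c))" by (rule ext)
    moreover have "(\<Sum>(b, c)\<in>B \<times> B. \<omega> [b, c] *\<^sub>R E (b, c)) \<in> span (E ` (B \<times> B))"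
      unfolding case_prod_beta by (intro span_sum span_scale span_base) auto
    ultimately show ?thesis by simp
  qed
  then show ?thesis using that[of "E ` (B \<times> B)"] finite_B by auto
qed

lemma betti_2_zero:
  assumes "betti br 2 = 0"
  shows "cocycles br 2 \<subseteq> ce_diff br ` forms 1"
proof -
  have cob: "coboundaries br 2 = ce_diff br ` forms 1" by (simp add: numeral_2_eq_2)
  have sub: "subspace (ce_diff br ` (forms 1 :: ('a list \<Rightarrow> real) set))"
    by (intro linear_subspace_image linear_ce_diff subspace_forms)
  have "cocycles br 2 = forms 2 \<inter> {\<omega>. ce_diff br \<omega> = 0}" by (auto simp: cocycles_def)
  then have coc: "subspace (cocycles br 2)"
    by (simp add: subspace_inter subspace_forms linear_subspace_kernel linear_ce_diff)
  obtain F :: "('a list \<Rightarrow> real) set" where F: "finite F" "forms 2 \<subseteq> span F" by (rule forms_2_finite_span)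
  have "\<exists>B. quot_basis (cocycles br 2) (ce_diff br ` forms 1) B"
    by (rule quot_basis_exists[OF coc sub _ F(1)]) (use ce_diff_forms_1 F(2) in \<open>auto simp: cocycles_def\<close>)
  then obtain B where B: "quot_basis (cocycles br 2) (ce_diff br ` forms 1) B" by (elim exE)
  interpret quotient_basis "cocycles br 2" "ce_diff br ` forms 1" B
    by unfold_locales (use B coc sub ce_diff_forms_1 in auto)
  have "card B = 0"
    using assms quot_dim_eq[OF B coc sub WV] by (simp add: betti_def cob)
  then show ?thesis using basis_empty_iff finite_B by auto
qed

text \<open>For the kernel \<open>N\<close> of a closed 1-form \<open>e\<close> and \<open>t\<close> with \<open>e(t) = 1\<close>, the closed form \<open>e \<and> \<gamma>\<close>, where \<open>\<gamma>\<close> vanishes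
  on \<open>[N, N]\<close>, is exact only if \<open>\<gamma>\<close> factors through \<open>ad t\<close> on \<open>N\<close>. So \<open>b\<^sub>2 = 0\<close> makes \<open>ad t\<close> injective,
  hence surjective, on \<open>N / [N, N]\<close>.\<close>

lemma derived_algebra_codim_1:
  assumes b2: "cocycles br 2 \<subseteq> ce_diff br ` forms 1" and v: "v \<notin> derived_series br 1"
  shows "\<exists>r. x - r *\<^sub>R v \<in> derived_series br 1"
proof -
  let ?h = "derived_series br 1"
  have sh: "subspace ?h" by (rule ideal_subspace[OF derived_ideal])
  have br_h: "br x y \<in> ?h" for x y by (simp add: bracket_span_base)
  obtain e :: "'a \<Rightarrow> real" where e: "linear e" "e v = 1" "\<forall>x\<in>?h. e x = 0"
    by (rule separating_functional[OF sh v])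
  define N where "N = {x. e x = 0}"
  let ?N' = "bracket_span br N N"
  have sN: "subspace N" unfolding N_def by (rule linear_subspace_kernel[OF e(1)])
  have sN': "subspace ?N'" by (rule subspace_bracket_span)
  have hN: "?h \<subseteq> N" using e(3) by (auto simp: N_def)
  have N'h: "?N' \<subseteq> ?h" by (intro bracket_span_least sh br_h)
  have NI: "lie_ideal br N" unfolding lie_ideal_def using sN hN br_h by auto
  have N'I: "lie_ideal br ?N'" by (intro bracket_span_ideal NI)
  have inj: "y \<in> ?N'" if y: "y \<in> N" "br v y \<in> ?N'" for y
  proof (rule ccontr)
    assume "y \<notin> ?N'"
    then obtain g :: "'a \<Rightarrow> real" where g: "linear g" "g y = 1" "\<forall>x\<in>?N'. g x = 0"
      by (rule separating_functional[OF sN'])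
    \<comment> \<open>Split both arguments into a multiple of \<open>v\<close> and a part in
      \<open>N\<close>; the functional \<open>g\<close> kills the bracket of the two parts in
      \<open>N\<close>.\<close>
    have g_br: "g (br a b) = e a * g (br v b) - e b * g (br v a)" for a b
    proof -
      have "br (a - e a *\<^sub>R v) (b - e b *\<^sub>R v) \<in> ?N'"
        by (intro bracket_span_base) (simp_all add: N_def linear_diff[OF e(1)] linear_scale[OF e(1)] e(2))
      from bspec[OF g(3) this] show ?thesis
        using br_swap[of a v]
        by (simp add: br_left br_right br_self linear_add[OF g(1)] linear_diff[OF g(1)] linear_scale[OF g(1)] linear_neg[OF g(1)])
    qed
    define s where "s a b = e a * g b - e b * g a" for a b
    define \<sigma> where "\<sigma> xs = (if length xs = 2 then s (xs ! 0) (xs ! 1) else 0)" for xs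
    have \<sigma>2: "\<sigma> [a, b] = s a b" for a b by (simp add: \<sigma>_def)
    have \<sigma>: "\<sigma> \<in> forms 2"
      unfolding \<sigma>_def
    proof (rule form_2_of_bilinear)
      show "linear (\<lambda>a. s a b)" for b unfolding s_def
        by (rule linearI) (simp_all add: linear_add[OF e(1)] linear_add[OF g(1)] linear_scale[OF e(1)] linear_scale[OF g(1)] algebra_simps)
      show "linear (s a)" for a unfolding s_def
        by (rule linearI) (simp_all add: linear_add[OF e(1)] linear_add[OF g(1)] linear_scale[OF e(1)] linear_scale[OF g(1)] algebra_simps)
    qed (simp add: s_def)
    have "ce_diff br \<sigma> xs = 0" for xs
    proof (cases "length xs = 3")
      case True
      then obtain a b c where xs: "xs = [a, b, c]" by (rule length_3_cases)
      have s_br: "s (br p q) r = - (e r * (e p * g (br v q) - e q * g (br v p)))" for p q r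
        unfolding s_def g_br[symmetric] using bspec[OF e(3) br_h] by simp
      show ?thesis unfolding xs ce_diff_2 \<sigma>2 s_br by (simp add: algebra_simps)
    next
      case False
      then show ?thesis using ce_diff_length[OF \<sigma>] by simp
    qed
    then have "\<sigma> \<in> cocycles br 2" using \<sigma> by (simp add: cocycles_def fun_eq_iff)
    then obtain f where f: "f \<in> forms 1" "\<sigma> = ce_diff br f" using b2 by auto
    note lin = forms_1_linear[OF f(1)]
    have s_f: "s a b = - f [br a b]" for a b using \<sigma>2[of a b] by (simp add: f(2) ce_diff_1)
    \<comment> \<open>The 2-form \<open>s\<close> is the wedge of \<open>e\<close> and
      \<open>g\<close>, so it vanishes on \<open>N\<close>, and its primitive \<open>f\<close> kills
      [N, N]. As [v, y] lies there, s(v, y) = 0, whereas e(v) g(y) = 1.\<close>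
    have "?N' \<subseteq> {x. f [x] = 0}"
    proof (intro bracket_span_least linear_subspace_kernel lin)
      fix a b assume "a \<in> N" "b \<in> N"
      then show "br a b \<in> {x. f [x] = 0}" using s_f[of a b] by (simp add: s_def N_def)
    qed
    then have "s v y = 0" using y(2) s_f[of v y] by auto
    then show False using e(2) y(1) g(2) by (simp add: s_def N_def)
  qed
  have "\<exists>B. quot_basis N ?N' B"
    using quot_basis_exists[OF sN sN' _ finite_S] span_S N'h hN by auto
  then obtain B where B: "quot_basis N ?N' B" by (elim exE)
  interpret quotient_basis N ?N' B by unfold_locales (use B sN sN' N'h hN in auto)
  have pres: "preserves (br v)"
    unfolding preserves_def using linear_ad ideal_br[OF NI] ideal_br[OF N'I] by auto
  \<comment> \<open>Surjectivity of \<open>br v\<close> on N/[N, N] writes every element of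
    \<open>N\<close> as a bracket plus an element of [N, N]. So the derived algebra is the whole
    kernel of \<open>e\<close>.\<close>
  have Nh: "N \<subseteq> ?h"
  proof
    fix y assume y: "y \<in> N"
    have "\<exists>u\<in>N. y - br v u \<in> ?N'"
      by (rule injective_imp_surjective[OF pres _ y]) (rule inj)
    then obtain u where "y - br v u \<in> ?N'" by (elim bexE)
    then have "y - br v u \<in> ?h" by (rule subsetD[OF N'h])
    then have "y - br v u + br v u \<in> ?h" by (intro subspace_add[OF sh] br_h)
    then show "y \<in> ?h" by simp
  qed
  have "x - e x *\<^sub>R v \<in> N" by (simp add: N_def linear_diff[OF e(1)] linear_scale[OF e(1)] e(2))
  then show ?thesis by (intro exI subsetD[OF Nh])
qed

text \<open>The traces on the successive quotients telescope by additivity, starting from the trace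
  on N/N.\<close>

lemma central_series_trace:
  assumes N: "lie_ideal br N" and tr: "\<And>i. quot_trace (br x) (central_series br N i) (central_series br N (Suc i)) = 0"
  shows "quot_trace (br x) N (central_series br N i) = 0"
proof (induction i)
  case 0
  obtain B where B: "quot_basis N N B"
    using quot_basis_exists[OF ideal_subspace[OF N] ideal_subspace[OF N] subset_refl finite_S] span_S by auto
  interpret quotient_basis N N B by unfold_locales (use B ideal_subspace[OF N] in auto)
  show ?case
    using quot_trace_eq[OF B V W] linear_ad ideal_br[OF N] tr_0[of "br x"] by (simp add: image_subset_iff)
next
  case (Suc i)
  let ?C = "central_series br N"
  have I: "lie_ideal br (?C i)" for i by (intro central_ideal N)
  have le: "?C i \<subseteq> N" for i
    by (induction i) (use central_Suc_subset[OF N] in \<open>auto simp del: central_series.simps(2)\<close>)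
  have "quot_trace (br x) N (?C (Suc i)) = quot_trace (br x) N (?C i) + quot_trace (br x) (?C i) (?C (Suc i))"
    by (rule quot_trace_additive[OF ideal_subspace[OF N] ideal_subspace[OF I] ideal_subspace[OF I] le
          central_Suc_subset[OF N] finite_S])
      (use span_S linear_ad ideal_br[OF N] ideal_br[OF I] in \<open>auto simp del: central_series.simps\<close>)
  then show ?case using Suc tr by simp
qed

end

section \<open>Exact G2-structures\<close>

text \<open>If \<open>v\<close> and \<open>w\<close> were independent, then \<open>\<iota>\<^sub>v\<phi> \<and> \<iota>\<^sub>v\<phi> \<and> \<phi>\<close> could be evaluated on a basis containing both;
  in each term of the expansion one of the three factors has \<open>v\<close> and \<open>w\<close>, or \<open>\<iota>\<^sub>v\<phi>\<close> has one of them, as arguments.\<close>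

lemma g2_structure_contract2:
  fixes \<phi> :: "'a::real_vector list \<Rightarrow> real"
  assumes g2: "g2_structure \<phi>" and dim7: "dim (UNIV :: 'a set) = 7"
    and v: "v \<noteq> 0" and vw: "\<And>z. \<phi> [v, w, z] = 0"
  shows "w \<in> span {v}"
proof (rule ccontr)
  assume w: "w \<notin> span {v}"
  have \<phi>: "\<phi> \<in> forms 3" using g2 by (simp add: g2_structure_def)
  note sw = forms_3_swap[OF \<phi>]
  let ?\<omega> = "contract v \<phi>"
  let ?\<Omega> = "wedge 4 3 (wedge 2 2 ?\<omega> ?\<omega>) \<phi>"
  have "?\<omega> \<in> forms 2" using contract_in_forms[of \<phi> 2] \<phi> by (simp add: numeral_3_eq_3 numeral_2_eq_2)
  then have \<Omega>: "?\<Omega> \<in> forms 7" using wedge_in_forms[OF wedge_in_forms \<phi>, of ?\<omega> 2 ?\<omega> 2] by simp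
  have full: "span (set xs) = UNIV" if "?\<Omega> xs \<noteq> 0" for xs
  proof -
    note ind = forms_nonzero_independent[OF \<Omega> that]
    have "length xs = 7" using forms_length[OF \<Omega>] that by blast
    then have card: "card (set xs) = 7" using ind(1) distinct_card by metis
    obtain D where D: "independent D" "span D = (UNIV :: 'a set)" "card D = 7"
      using basis_exists[of "UNIV :: 'a set"] unfolding dim7 by (metis top.extremum_uniqueI)
    have finD: "finite D" by (rule ccontr) (use D(3) in simp)
    show ?thesis
    proof (rule ccontr)
      assume "span (set xs) \<noteq> UNIV"
      then have "dim (span (set xs)) < dim (UNIV :: 'a set)"
        by (intro dim_psubset_less[OF finD]) (use D in auto)
      then show False using ind(2) card dim7 by (simp add: dim_eq_card_independent)
    qed
  qed
  have "?\<Omega> \<noteq> 0" using g2 v by (simp add: g2_structure_def)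
  then obtain xs where xs: "?\<Omega> xs \<noteq> 0" by (metis ext zero_fun_apply)
  \<comment> \<open>A nonzero value of the 7-form forces its arguments to span. So \<open>v\<close>
    can be exchanged into the tuple, and \<open>w\<close> after it with the position of
    \<open>v\<close> protected, because \<open>w\<close> is not a multiple of
    \<open>v\<close>.\<close>
  have v': "v \<in> span (set xs)" "v \<notin> span ((!) xs ` {})" using full[OF xs] v by auto
  obtain i where i: "i < 7" "?\<Omega> (xs[i := v]) \<noteq> 0"
    by (rule forms_exchange[OF \<Omega> xs v'])
  have len: "length xs = 7" using forms_length[OF \<Omega>] xs by blast
  have w': "w \<in> span (set (xs[i := v]))" "w \<notin> span ((!) (xs[i := v]) ` {i})"
    using full[OF i(2)] w len i(1) by auto
  obtain j where j: "j < 7" "j \<notin> {i}" "?\<Omega> (xs[i := v, j := w]) \<noteq> 0"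
    by (rule forms_exchange[OF \<Omega> i(2) w'])
  define ys where "ys = xs[i := v, j := w]"
  have mem: "v \<in> set ys" "w \<in> set ys"
  proof -
    have "ys ! i = v" "ys ! j = w" using i j len by (auto simp: ys_def)
    then show "v \<in> set ys" "w \<in> set ys" using i(1) j(1) len by (metis length_list_update nth_mem ys_def)+
  qed
  have vv: "\<phi> [v, v, z] = 0" for z
    using sw(1)[of v v z] by simp
  have \<omega>0: "?\<omega> as = 0" if as: "length as = 2" "v \<in> set as \<or> w \<in> set as" for as
  proof -
    obtain s t where "as = [s, t]" using as(1) by (auto simp: numeral_2_eq_2 length_Suc_conv)
    then show ?thesis using as(2) vv vw sw(2)[of v s t] by (auto simp: contract_def)
  qed
  have "wedge 2 2 ?\<omega> ?\<omega> as = 0 \<or> \<phi> bs = 0"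
    if as: "length as = 4" "length bs = 3" "set as \<union> set bs = set ys" for as bs
  proof (cases "v \<in> set as \<or> w \<in> set as")
    case True
    have "wedge 2 2 ?\<omega> ?\<omega> as = 0"
    proof (rule wedge_eq_0)
      fix cs ds :: "'a list"
      assume "length cs = 2" "length ds = 2" "set cs \<union> set ds = set as"
      then show "?\<omega> cs = 0 \<or> ?\<omega> ds = 0" using True \<omega>0[of cs] \<omega>0[of ds] by blast
    qed
    then show ?thesis ..
  next
    case False
    then have "v \<in> set bs" "w \<in> set bs" using as(3) mem by auto
    moreover obtain r s t where bs: "bs = [r, s, t]" using as(2) by (auto simp: numeral_3_eq_3 length_Suc_conv)
    moreover have "v \<noteq> w" using w span_base[of v "{v}"] by auto
    moreover have "\<phi> [v, z, w] = 0" "\<phi> [w, v, z] = 0" "\<phi> [w, z, v] = 0" "\<phi> [z, v, w] = 0" "\<phi> [z, w, v] = 0" for z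
      using sw(2)[of v w z] sw(1)[of w v z] sw(2)[of w v z] sw(1)[of z v w] sw(1)[of z w v] sw(2)[of z v w] vw[of z]
      by simp_all
    ultimately have "\<phi> bs = 0" using vw by auto
    then show ?thesis ..
  qed
  then have "?\<Omega> ys = 0" by (intro wedge_eq_0) auto
  then show False using j(3) by (simp add: ys_def)
qed

context finite_dim_lie_algebra begin

lemma derived_algebra_proper:
  assumes "solvable br" "UNIV \<noteq> {0 :: 'a}"
  shows "derived_series br 1 \<noteq> UNIV"
proof
  assume eq: "derived_series br 1 = UNIV"
  have "derived_series br i = UNIV" for i
    by (induction i) (use eq in simp_all)
  then show False using assms by (auto simp: solvable_def)
qed

text \<open>Bracketing with the nilradical sends the last nonzero term to the next one, which is
  zero. Of the two trace statements, the former is the unimodularity condition for this last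
  quotient, the latter the sum of the conditions before it.\<close>

lemma last_central_term:
  assumes su: "strongly_unimodular br" and ne: "nilradical br \<noteq> {0}"
    and N: "lie_ideal br (nilradical br)" "\<exists>i. central_series br (nilradical br) i = {0}"
  obtains Z where "lie_ideal br Z" "Z \<noteq> {0}" "Z \<subseteq> nilradical br"
    "\<And>x y. x \<in> nilradical br \<Longrightarrow> y \<in> Z \<Longrightarrow> br x y = 0"
    "\<And>x. quot_trace (br x) Z {0} = 0" "\<And>x. quot_trace (br x) (nilradical br) Z = 0"
proof -
  let ?N = "nilradical br"
  let ?C = "central_series br ?N"
  have tr: "quot_trace (br x) (?C i) (?C (Suc i)) = 0" for x i
    using su by (simp add: strongly_unimodular_def)
  define s where "s = (LEAST i. ?C i = {0})"
  have s: "?C s = {0}" unfolding s_def by (rule LeastI_ex[OF N(2)])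
  then obtain k where k: "s = Suc k" using ne by (cases s) auto
  have Z0: "?C k \<noteq> {0}" using not_less_Least[of k "\<lambda>i. ?C i = {0}"] k by (simp add: s_def)
  have I: "lie_ideal br (?C k)" by (intro central_ideal N)
  have le: "?C i \<subseteq> ?N" for i
    by (induction i) (use central_Suc_subset[OF N(1)] in \<open>auto simp del: central_series.simps(2)\<close>)
  show ?thesis
  proof (rule that[of "?C k"])
    show "br x y = 0" if "x \<in> ?N" "y \<in> ?C k" for x y
      using bracket_span_base[OF that] s k by simp
    show "quot_trace (br x) (?C k) {0} = 0" for x using tr[of x k] s k by simp
    show "quot_trace (br x) ?N (?C k) = 0" for x by (rule central_series_trace[OF N(1) tr])
  qed (use I Z0 le in auto)
qed

text \<open>All brackets lie in \<open>N\<close>, so \<open>br x\<close> induces zero on the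
  quotient by \<open>N\<close>, which adds nothing to the trace.\<close>

lemma trace_UNIV:
  assumes N: "lie_ideal br N" "\<And>x y. br x y \<in> N" and Z: "lie_ideal br Z" "Z \<subseteq> N"
  shows "quot_trace (br x) UNIV Z = quot_trace (br x) N Z"
proof -
  note sN = ideal_subspace[OF N(1)] and sZ = ideal_subspace[OF Z(1)]
  obtain B where B: "quot_basis UNIV N B"
    using quot_basis_exists[OF subspace_UNIV sN subset_UNIV finite_S] span_S by auto
  interpret quotient_basis UNIV N B by unfold_locales (use B sN in auto)
  have "quot_trace (br x) UNIV N = 0"
    using quot_trace_eq[OF B V W] linear_ad N tr_0[of "br x"] by (simp add: image_subset_iff)
  moreover have "quot_trace (br x) UNIV Z = quot_trace (br x) UNIV N + quot_trace (br x) N Z"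
    by (rule quot_trace_additive[OF subspace_UNIV sN sZ subset_UNIV Z(2) finite_S])
      (use span_S linear_ad ideal_br[OF N(1)] ideal_br[OF Z(1)] in auto)
  ultimately show ?thesis by simp
qed

text \<open>If \<open>x\<close> is central and \<open>\<phi> = d\<alpha>\<close>, then \<open>\<iota>\<^sub>x\<phi>\<close> is the exact symplectic form \<open>-d(\<iota>\<^sub>x\<alpha>)\<close> on the quotient by \<open>x\<close>.
  The vector \<open>v\<close> dual to its primitive satisfies \<open>tr (ad v) = 3\<close>, against unimodularity.\<close>

lemma exact_symplectic_not_unimodular:
  assumes \<xi>: "linear (\<xi> :: 'a \<Rightarrow> real)" and Z: "\<And>x. x \<in> Z \<longleftrightarrow> (\<forall>y. \<xi> (br x y) = 0)" "\<And>x. x \<in> Z \<Longrightarrow> \<xi> x = 0"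
    and ne: "Z \<noteq> UNIV"
  shows "\<exists>v. quot_trace (br v) UNIV Z \<noteq> 0"
proof -
  define \<omega> where "\<omega> x y = \<xi> (br x y)" for x y
  have "Z = (\<Inter>y. {x. \<xi> (br x y) = 0})" using Z(1) by auto
  moreover have "linear (\<lambda>x. \<xi> (br x y))" for y
    using linear_compose[OF linear_br_left \<xi>] by (simp add: o_def)
  ultimately have sZ: "subspace Z"
    by (auto intro!: subspace_Inter linear_subspace_kernel)
  obtain B where B: "quot_basis UNIV Z B"
    using quot_basis_exists[OF subspace_UNIV sZ subset_UNIV finite_S] span_S by auto
  interpret skew_form \<omega> Z B
  proof (rule skew_form.intro)
    show "linear (\<omega> x)" for x
      using linear_compose[OF linear_ad \<xi>] by (simp add: o_def \<omega>_def[abs_def])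
    show "\<omega> x y = - \<omega> y x" for x y using br_swap[of x y] by (simp add: \<omega>_def linear_neg[OF \<xi>])
  qed (use Z(1) B in \<open>auto simp: \<omega>_def\<close>)
  obtain v where v: "\<omega> v = \<xi>" by (rule represent_functional[OF \<xi> Z(2)])
  \<comment> \<open>By Jacobi the left side is the value of \<xi> at [v, [x, y]], that is
    \<omega>(v, [x, y]), and \<omega>(v, -) is \<xi> by the choice of \<open>v\<close>. So
    \<open>br v\<close> satisfies the hypothesis of \<open>trace_conformal\<close>.\<close>
  have "\<omega> (br v x) y + \<omega> x (br v y) = \<omega> x y" for x y
  proof -
    have "\<omega> (br v x) y + \<omega> x (br v y) = \<xi> (br v (br x y))"
      by (simp add: \<omega>_def br_br_left linear_diff[OF \<xi>])
    also have "\<dots> = \<xi> (br x y)" using fun_cong[OF v, of "br x y"] by (simp add: \<omega>_def)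
    finally show ?thesis by (simp add: \<omega>_def)
  qed
  then have "2 * quot_trace (br v) UNIV Z = real (card B)" by (rule trace_conformal[OF linear_ad])
  moreover have "card B \<noteq> 0" using basis_empty_iff finite_B ne by auto
  ultimately show ?thesis by (intro exI[of _ v]) auto
qed

section \<open>Nonexistence, by the dimension of the last central term\<close>

lemma no_exact_g2_structure:
  assumes dim7: "dim (UNIV :: 'a set) = 7" and ttt: "two_three_trivial br" and su: "strongly_unimodular br"
    and g2: "g2_structure \<phi>" and \<phi>: "exact_form br 3 \<phi>"
  shows False
proof -
  have sol: "solvable br" using su by (simp add: strongly_unimodular_def)
  define h where "h = derived_series br 1"
  have hI: "lie_ideal br h" unfolding h_def by (rule derived_ideal)
  have br_h: "br x y \<in> h" for x y by (simp add: h_def bracket_span_base)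
  have ne0: "UNIV \<noteq> {0 :: 'a}"
  proof
    assume "UNIV = {0 :: 'a}"
    then have "dim (UNIV :: 'a set) = dim (span {} :: 'a set)" by (simp only: span_empty)
    also have "\<dots> = 0" unfolding dim_span using dim_eq_card_independent[OF independent_empty] by simp
    finally show False using dim7 by simp
  qed
  have "h \<noteq> UNIV" unfolding h_def by (rule derived_algebra_proper[OF sol ne0])
  then obtain t where t: "t \<notin> h" by auto
  have codim: "\<exists>r. x - r *\<^sub>R v \<in> h" if "v \<notin> h" for x v
    unfolding h_def
  proof (rule derived_algebra_codim_1)
    show "cocycles br 2 \<subseteq> ce_diff br ` forms 1"
      using ttt by (intro betti_2_zero) (simp add: two_three_trivial_def)
  qed (use that h_def in simp)
  have h0: "h \<noteq> {0}"
  proof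
    assume "h = {0}"
    then have "x \<in> span {t}" for x using codim[OF t, of x] by (auto simp: span_singleton)
    then have "UNIV = span {t}" by auto
    then have "dim (UNIV :: 'a set) \<le> card {t}" by (metis dim_le_card finite.emptyI finite.insertI order_refl)
    then show False using dim7 by simp
  qed
  have nil: "nilradical br = h"
    unfolding h_def by (rule nilradical_eq_derived[OF sol]) (use h0 codim h_def in auto)
  have "\<exists>i. central_series br h i = {0}" unfolding h_def by (rule derived_algebra_nilpotent[OF sol])
  then obtain Z where ZI: "lie_ideal br Z" and Z0: "Z \<noteq> {0}" and Zh: "Z \<subseteq> h"
    and central: "\<And>x y. x \<in> h \<Longrightarrow> y \<in> Z \<Longrightarrow> br x y = 0"
    and trZ: "\<And>x. quot_trace (br x) Z {0} = 0" and trh: "\<And>x. quot_trace (br x) h Z = 0"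
    using last_central_term[OF su] hI h0 unfolding nil by metis
  note sZ = ideal_subspace[OF ZI]
  obtain \<alpha> where \<alpha>: "\<alpha> \<in> forms 2" "\<phi> = ce_diff br \<alpha>"
    using \<phi> by (auto simp: exact_form_def numeral_3_eq_3 numeral_2_eq_2)
  note \<alpha>lin = forms_2_linear[OF \<alpha>(1)]
  have \<alpha>_swap: "\<alpha> [x, y] = - \<alpha> [y, x]" for x y by (rule forms_2_swap[OF \<alpha>(1)])
  have \<phi>_def: "\<phi> [x, y, z] = - \<alpha> [br x y, z] + \<alpha> [br x z, y] - \<alpha> [br y z, x]" for x y z
    by (simp add: \<alpha>(2) ce_diff_2)
  have \<phi>3: "\<phi> \<in> forms 3" using g2 by (simp add: g2_structure_def)
  note claim = g2_structure_contract2[OF g2 dim7]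
  have central': "br y x = 0" if "x \<in> h" "y \<in> Z" for x y
    using central[OF that] br_swap[of y x] by simp
  have \<phi>t: "\<phi> [x, y, t] = \<alpha> [br t y, x] - \<alpha> [br t x, y]" if "x \<in> Z" "y \<in> Z" for x y
  proof -
    have "br x y = 0" using central that Zh by auto
    then show ?thesis
      using br_swap[of x t] br_swap[of y t]
      by (simp add: \<phi>_def linear_0[OF \<alpha>lin(1)] linear_neg[OF \<alpha>lin(1)])
  qed
  have dep: "y \<in> span {x}" if xy: "x \<in> Z" "y \<in> Z" "x \<noteq> 0" "\<phi> [x, y, t] = 0" for x y
  proof (rule claim[OF xy(3)])
    fix z
    obtain r where r: "z - r *\<^sub>R t \<in> h" using codim[OF t] by blast
    have "br x y = 0" using central xy Zh by auto
    then have "\<phi> [x, y, z - r *\<^sub>R t] = 0"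
      using central'[OF r] xy by (simp add: \<phi>_def linear_0[OF \<alpha>lin(1)])
    then show "\<phi> [x, y, z] = 0"
      using xy(4) by (simp add: linear_diff[OF forms_3_linear[OF \<phi>3]] linear_scale[OF forms_3_linear[OF \<phi>3]])
  qed
  have "\<exists>B. quot_basis Z {0} B"
    using quot_basis_exists[OF sZ subspace_single_0 _ finite_S] span_S subspace_0[OF sZ] by auto
  then obtain B where B: "quot_basis Z {0} B" by (elim exE)
  interpret quotient_basis Z "{0}" B
    by unfold_locales (use B sZ subspace_0[OF sZ] in auto)
  let ?c = "quot_coord {0} B"
  have BZ: "b \<in> Z" if "b \<in> B" for b using B_sub that by auto
  have B_nonzero: "b \<noteq> 0" if "b \<in> B" for b
  proof
    assume "b = 0"
    then have "?c b b = 0" by (intro coord_W) simp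
    then show False using that by (simp add: coord_basis)
  qed
  have B_indep: "c \<notin> span {b}" if "b \<in> B" "c \<in> B" "b \<noteq> c" for b c
  proof
    assume "c \<in> span {b}"
    then obtain r where "c = r *\<^sub>R b" by (auto simp: span_singleton)
    then have "?c c c = r * ?c b c" using coord_scale[OF BZ[OF that(1)], of r c] by simp
    then show False using that by (simp add: coord_basis)
  qed
  have expand: "v = (\<Sum>b\<in>B. ?c v b *\<^sub>R b)" if "v \<in> Z" for v
    using quot_coord_spec(2)[OF B that] by simp
  have trB: "(\<Sum>b\<in>B. ?c (br t b) b) = 0"
    using trZ[of t] quot_trace_eq[OF B V W WV linear_ad, of t] ideal_br[OF ZI]
    by (simp add: basis_trace_def image_subset_iff br_right)
  have tZ: "br t z \<in> Z" if "z \<in> Z" for z using ideal_br[OF ZI that] .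
  have "card B = 0 \<or> card B = 1 \<or> card B = 2 \<or> card B \<ge> 3" by linarith
  then consider "B = {}" | b where "B = {b}" | a b where "B = {a, b}" "a \<noteq> b"
    | a b c where "a \<in> B" "b \<in> B" "c \<in> B" "a \<noteq> b" "a \<noteq> c" "b \<noteq> c"
  proof (elim disjE)
    assume "card B = 0"
    then show thesis using that(1) finite_B by simp
  next
    assume "card B = 1"
    then show thesis using that(2) by (auto simp: card_1_singleton_iff)
  next
    assume "card B = 2"
    then show thesis using that(3) by (auto simp: card_2_iff)
  next
    assume "card B \<ge> 3"
    then obtain T where "T \<subseteq> B" "card T = 3" using obtain_subset_with_card_n by metis
    then show thesis using that(4) by (auto simp: card_3_iff)
  qed
  then show False
  proof cases
    case 1
    then show False using basis_empty_iff Z0 by simp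
  next
    case (2 b)
    have b: "b \<in> Z" "b \<noteq> 0" using BZ B_nonzero 2 by auto
    have Zb: "Z = span {b}"
      using expand 2 b(1) sZ by (intro subset_antisym span_minimal) (auto simp: span_singleton)
    \<comment> \<open>On a line the trace is the factor by which the operator scales, so
      tracelessness means that \<open>t\<close> commutes with \<open>b\<close>.\<close>
    have "br t b = 0" using expand[OF tZ[OF b(1)]] trB 2 by simp
    have b_central: "br b y = 0" for y
    proof -
      obtain r where "y - r *\<^sub>R t \<in> h" using codim[OF t] by blast
      then have "br b (y - r *\<^sub>R t) = 0" using central' b by simp
      then show ?thesis using \<open>br t b = 0\<close> br_swap[of b t] by (simp add: br_right)
    qed
    have \<phi>b: "\<phi> [b, y, z] = \<alpha> [b, br y z]" for y z
      using \<alpha>_swap[of "br y z" b] by (simp add: \<phi>_def b_central linear_0[OF \<alpha>lin(1)])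
    have "\<exists>v. quot_trace (br v) UNIV Z \<noteq> 0"
    proof (rule exact_symplectic_not_unimodular[OF \<alpha>lin(2)[of b]])
      \<comment> \<open>The radical of the contraction of \<phi> with \<open>b\<close> is exactly
        the line of \<open>b\<close>: one inclusion is centrality, the other is nondegeneracy of the
        G2-structure.\<close>
      show "x \<in> Z \<longleftrightarrow> (\<forall>y. \<alpha> [b, br x y] = 0)" for x
      proof
        assume "x \<in> Z"
        then show "\<forall>y. \<alpha> [b, br x y] = 0"
          by (auto simp: Zb span_singleton br_left b_central linear_0[OF \<alpha>lin(2)])
      next
        assume "\<forall>y. \<alpha> [b, br x y] = 0"
        then show "x \<in> Z" unfolding Zb by (intro claim[OF b(2)]) (simp add: \<phi>b)
      qed
      show "\<alpha> [b, x] = 0" if "x \<in> Z" for x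
        using that \<alpha>_swap[of b b] by (auto simp: Zb span_singleton linear_scale[OF \<alpha>lin(2)])
    qed (use Zh \<open>h \<noteq> UNIV\<close> in auto)
    moreover have "quot_trace (br v) UNIV Z = 0" for v
      using trace_UNIV[OF hI br_h ZI Zh] trh by simp
    ultimately show False by simp
  next
    case (3 a b)
    have ab: "a \<in> Z" "b \<in> Z" using BZ 3 by auto
    have ex: "br t z = ?c (br t z) a *\<^sub>R a + ?c (br t z) b *\<^sub>R b" if "z \<in> Z" for z
      using expand[OF tZ[OF that]] 3 by simp
    have self: "\<alpha> [x, x] = 0" for x using \<alpha>_swap[of x x] by simp
    have "\<alpha> [br t a, b] = ?c (br t a) a * \<alpha> [a, b]"
      by (subst ex[OF ab(1)]) (simp add: linear_add[OF \<alpha>lin(1)] linear_scale[OF \<alpha>lin(1)] self)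
    moreover have "\<alpha> [br t b, a] = - (?c (br t b) b * \<alpha> [a, b])"
      using \<alpha>_swap[of b a]
      by (subst ex[OF ab(2)]) (simp add: linear_add[OF \<alpha>lin(1)] linear_scale[OF \<alpha>lin(1)] self)
    moreover have "?c (br t a) a + ?c (br t b) b = 0" using trB 3 by simp
    then have "?c (br t b) b = - ?c (br t a) a" by linarith
    ultimately have "\<phi> [a, b, t] = 0" by (simp add: \<phi>t[OF ab])
    then have "b \<in> span {a}" using ab B_nonzero 3 by (intro dep) auto
    then show False using B_indep[of a b] 3 by auto
  next
    case (4 a b c)
    have lin: "linear (\<lambda>y. \<phi> [a, y, t])"
    proof -
      have "(\<lambda>y. \<phi> [a, y, t]) = (\<lambda>y. - \<phi> [a, t, y])" by (rule ext) (rule forms_3_swap(2)[OF \<phi>3])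
      then show ?thesis using linear_compose_neg[OF forms_3_linear[OF \<phi>3, of a t]] by simp
    qed
    \<comment> \<open>The combination of \<open>b\<close> and \<open>c\<close> on which \<phi>(a, -,
      t) vanishes. By \<open>dep\<close> it is a multiple of \<open>a\<close>; comparing coordinates
      at \<open>c\<close> gives \<phi>(a, b, t) = 0, and \<open>dep\<close> makes \<open>b\<close> a
      multiple of \<open>a\<close>.\<close>
    define u where "u = \<phi> [a, c, t] *\<^sub>R b - \<phi> [a, b, t] *\<^sub>R c"
    have uZ: "u \<in> Z" unfolding u_def using BZ 4 sZ by (intro subspace_diff subspace_scale) auto
    have "\<phi> [a, u, t] = 0" unfolding u_def by (simp add: linear_diff[OF lin] linear_scale[OF lin])
    then have "u \<in> span {a}" using uZ BZ B_nonzero 4 by (intro dep) auto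
    then obtain r where r: "u = r *\<^sub>R a" by (auto simp: span_singleton)
    have "?c u c = r * ?c a c" unfolding r using BZ 4 by (intro coord_scale) auto
    moreover have "?c u c = - \<phi> [a, b, t]"
    proof -
      have "u = \<phi> [a, c, t] *\<^sub>R b + (- \<phi> [a, b, t]) *\<^sub>R c" by (simp add: u_def)
      then have "?c u c = \<phi> [a, c, t] * ?c b c + (- \<phi> [a, b, t]) * ?c c c"
        using BZ 4 sZ by (simp only: coord_add coord_scale subspace_scale)
      then show ?thesis using 4 by (simp add: coord_basis)
    qed
    ultimately have "\<phi> [a, b, t] = 0" using 4 by (simp add: coord_basis)
    then have "b \<in> span {a}" using BZ B_nonzero 4 by (intro dep) auto
    then show False using B_indep[of a b] 4 by auto
  qed
qed

end

theorem mainTheorem3: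
  fixes br :: "'a::real_vector \<Rightarrow> 'a \<Rightarrow> 'a"
  assumes "lie_algebra br"
    and "dim (UNIV :: 'a set) = 7"
    and "two_three_trivial br"
    and "strongly_unimodular br"
  shows "\<not> (\<exists>\<phi>. g2_structure \<phi> \<and> exact_form br 3 \<phi>)"
proof -
  obtain D :: "'a set" where D: "independent D" "UNIV \<subseteq> span D" "card D = dim (UNIV :: 'a set)"
    using basis_exists[of "UNIV :: 'a set"] by metis
  have "finite D" by (rule ccontr) (use D(3) assms(2) in simp)
  then interpret finite_dim_lie_algebra br D
    by unfold_locales (use assms D in auto)
  show ?thesis using no_exact_g2_structure assms by blast
qed

end
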